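(* Let $M\in\mathrm{M}_n(\mathbb{K})$ be a cyclic matrix with minimal polynomial $f=f_1^{m_1}\cdots f_s^{m_s}$, where $f_1,\dots,f_s\in\mathbb{K}[x]$ are pairwise distinct monic irreducible polynomials and $m_i\ge1$. Let $g\in\mathbb{L}[x]$ be a monic divisor of $f$ of degree $n-k$ with $k\ge1$, and write $g=g_1\cdots g_s$ with $g_i$ a monic divisor of $f_i^{m_i}$ in $\mathbb{L}[x]$. Set $d_i=m_i\deg f_i$, $k_i=m_i\deg f_i-\deg g_i$, $\Lambda=\{i : g_i\neq f_i^{m_i}\}$, and for $i\in\Lambda$ let $\mathcal{C}_i\subseteq\mathbb{L}^{d_i}$ be the $f_i^{m_i}$-polynomial code with generator polynomial $g_i$. Then for all $r\in\{1,\dots,k\}$, $$M_r(\mathcal{C}_g)=\min_{\substack{\sum_{i\in\Lambda}r_i=r\\ r_i\in\{0,\dots,k_i\}}}\sum_{i\in\Lambda}M_{r_i}(\mathcal{C}_i)\le\min_{\substack{\sum_{i\in\Lambda}r_i=r\\ r_i\in\{0,\dots,k_i\}}}\Big(\sum_{i\in\Lambda,\ r_i\neq0}\deg g_i\Big)+r,$$ and $M_{r_i}(\mathcal{C}_i)\le\deg(g_i)+r_i$ for all $i\in\Lambda$, $r_i\in\{1,\dots,k_i\}$. In particular $M_1(\mathcal{C}_g)=\min_{i\in\Lambda}M_1(\mathcal{C}_i)\le\min_{i\in\Lambda}\deg(g_i)+1$ and $M_k(\mathcal{C}_g)=\sum_{i\in\Lambda}M_{k_i}(\mathcal{C}_i)\le\sum_{i\in\Lambda}m_i\deg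 f_i$.
   Context: Let $\mathbb{L}/\mathbb{K}$ be a field extension of finite degree $m\ge n$. Vectors are row vectors. For $c=(c_1,\dots,c_d)\in\mathbb{L}^d$, $\mathrm{Rsupp}(c)$ is the $\mathbb{K}$-row space of the $m\times d$ matrix over $\mathbb{K}$ whose $j$-th column is the coordinate vector of $c_j$ in a fixed $\mathbb{K}$-basis of $\mathbb{L}$, $\mathrm{wt}_R(c)=\dim_{\mathbb{K}}\mathrm{Rsupp}(c)$; for an $\mathbb{L}$-subspace $\mathcal{D}$, $\mathrm{wt}_R(\mathcal{D})$ is the $\mathbb{K}$-dimension of the span of all $\mathrm{Rsupp}(d)$, $d\in\mathcal{D}$. For a $k$-dimensional $\mathbb{L}$-subspace (code) $\mathcal{C}$ and $1\le r\le k$, $M_r(\mathcal{C})=\min\{\mathrm{wt}_R(\mathcal{D}):\mathcal{D}\subseteq\mathcal{C},\dim_{\mathbb{L}}\mathcal{D}=r\}$, and $M_0(\mathcal{C})=0$. A matrix $M\in\mathrm{M}_n(\mathbb{K})$ is cyclic if there is $v\in\mathbb{K}^n$ (a cyclic vector) with $(v,vM^t,\dots,v(M^t)^{n-1})$ a basis; equivalently its minimal polynomial $f$ has degree $n$. For such $M$ and a monic divisor $g$ of $f$ in $\mathbb{L}[x]$, $\mathcal{C}_g=\{v\,g(M)^tP(M)^t : P\in\mathbb{L}[x]\}\subseteq\mathbb{L}^n$; it does not depend on the cyclic vector $v\in\mathbb{K}^n$, has dimension $n-\deg g$, and every $\mathbb{L}$-subspace of $\mathbb{L}^n$ stable under $c\mapsto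 cM^t$ (an $M$-cyclic code) equals $\mathcal{C}_g$ for a unique such $g$, its generator polynomial. For monic $\Theta=x^d+a_{d-1}x^{d-1}+\dots+a_0\in\mathbb{K}[x]$, the companion matrix $C_\Theta$ has ones on the subdiagonal, last column $(-a_0,\dots,-a_{d-1})^t$, zeros elsewhere; the $\Theta$-polynomial code with generator polynomial $g\mid\Theta$ is $\mathcal{C}_g$ for $M=C_\Theta$ (equivalently, the coefficient vectors in $\mathbb{L}^d$ of the degree-$<d$ representatives of the ideal $(\bar g)\subseteq\mathbb{L}[x]/(\Theta)$). *)

theory Defs
  imports Main "HOL-Computational_Algebra.Computational_Algebra" "HOL-Library.Function_Algebras"
begin

text \<open>Conventions. The field K is a type 'k, the field L a type 'l, and L/K is given by a
ring embedding emb. Vectors of K^d / L^d are functions nat => _ vanishing outside {..<d};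
n x n matrices are functions nat => nat => _ (only entries with indices < n are ever used).
The row vector w A^t equals the column action A w, which is what mat_vec computes.\<close>

definition vecs :: "nat \<Rightarrow> (nat \<Rightarrow> 'a::zero) set" where
  "vecs d = {c. \<forall>i\<ge>d. c i = 0}"

definition mat_vec :: "nat \<Rightarrow> (nat \<Rightarrow> nat \<Rightarrow> 'a::comm_semiring_0) \<Rightarrow> (nat \<Rightarrow> 'a) \<Rightarrow> nat \<Rightarrow> 'a" where
  "mat_vec n A w = (\<lambda>i. if i < n then (\<Sum>j<n. A i j * w j) else 0)"

fun mpow :: "nat \<Rightarrow> (nat \<Rightarrow> nat \<Rightarrow> 'a::comm_semiring_1) \<Rightarrow> nat \<Rightarrow> nat \<Rightarrow> nat \<Rightarrow> 'a" where
  "mpow n A 0 = (\<lambda>i j. if i = j then 1 else 0)"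
| "mpow n A (Suc t) = (\<lambda>i j. \<Sum>l<n. A i l * mpow n A t l j)"

definition poly_mat :: "nat \<Rightarrow> 'a::comm_semiring_1 poly \<Rightarrow> (nat \<Rightarrow> nat \<Rightarrow> 'a) \<Rightarrow> nat \<Rightarrow> nat \<Rightarrow> 'a" where
  "poly_mat n p A = (\<lambda>i j. \<Sum>t\<le>degree p. coeff p t * mpow n A t i j)"

definition annihilates :: "nat \<Rightarrow> 'a::comm_semiring_1 poly \<Rightarrow> (nat \<Rightarrow> nat \<Rightarrow> 'a) \<Rightarrow> bool" where
  "annihilates n p A \<longleftrightarrow> (\<forall>i<n. \<forall>j<n. poly_mat n p A i j = 0)"

definition is_min_poly :: "nat \<Rightarrow> (nat \<Rightarrow> nat \<Rightarrow> 'a::field) \<Rightarrow> 'a poly \<Rightarrow> bool" where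
  "is_min_poly n A f \<longleftrightarrow> lead_coeff f = 1 \<and> annihilates n f A \<and>
     (\<forall>p. p \<noteq> 0 \<and> annihilates n p A \<longrightarrow> degree f \<le> degree p)"

text \<open>v is a cyclic vector: (v, v A^t, ..., v (A^t)^(n-1)) is a basis of K^n, i.e. every w in K^n
has a unique coordinate tuple with respect to it.\<close>
definition cyclic_vec :: "nat \<Rightarrow> (nat \<Rightarrow> nat \<Rightarrow> 'a::field) \<Rightarrow> (nat \<Rightarrow> 'a) \<Rightarrow> bool" where
  "cyclic_vec n A v \<longleftrightarrow> v \<in> vecs n \<and>
     (\<forall>w\<in>vecs n. \<exists>!a. a \<in> vecs n \<and> (\<forall>j. w j = (\<Sum>i<n. a i * mat_vec n (mpow n A i) v j)))"

definition cyclic_mat :: "nat \<Rightarrow> (nat \<Rightarrow> nat \<Rightarrow> 'a::field) \<Rightarrow> bool" where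
  "cyclic_mat n A \<longleftrightarrow> (\<exists>v. cyclic_vec n A v)"

definition cyc_code :: "('k::field \<Rightarrow> 'l::field) \<Rightarrow> nat \<Rightarrow> (nat \<Rightarrow> nat \<Rightarrow> 'k) \<Rightarrow> 'l poly \<Rightarrow> (nat \<Rightarrow> 'l) set" where
  "cyc_code emb n A g =
     (let v = (SOME v. cyclic_vec n A v); AL = (\<lambda>i j. emb (A i j)); vL = (\<lambda>j. emb (v j))
      in {mat_vec n (poly_mat n P AL) (mat_vec n (poly_mat n g AL) vL) | P. True})"

definition companion :: "'a::comm_ring_1 poly \<Rightarrow> nat \<Rightarrow> nat \<Rightarrow> 'a" where
  "companion \<Theta> = (\<lambda>i j. if j + 1 = degree \<Theta> then - coeff \<Theta> i else if i = j + 1 then 1 else 0)"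

definition poly_code :: "('k::field \<Rightarrow> 'l::field) \<Rightarrow> 'k poly \<Rightarrow> 'l poly \<Rightarrow> (nat \<Rightarrow> 'l) set" where
  "poly_code emb \<Theta> g = cyc_code emb (degree \<Theta>) (companion \<Theta>) g"

definition vsc :: "'a::field \<Rightarrow> (nat \<Rightarrow> 'a) \<Rightarrow> nat \<Rightarrow> 'a" where
  "vsc a v = (\<lambda>j. a * v j)"

definition esc :: "('k::field \<Rightarrow> 'l::field) \<Rightarrow> 'k \<Rightarrow> 'l \<Rightarrow> 'l" where
  "esc emb a x = emb a * x"

definition field_ext :: "('k::field \<Rightarrow> 'l::field) \<Rightarrow> nat \<Rightarrow> bool" where
  "field_ext emb n \<longleftrightarrow> (\<forall>a b. emb (a + b) = emb a + emb b) \<and> (\<forall>a b. emb (a * b) = emb a * emb b)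
     \<and> emb 1 = 1 \<and>
     (\<exists>B. finite B \<and> \<not> module.dependent (esc emb) B \<and> module.span (esc emb) B = UNIV \<and> n \<le> card B)"

text \<open>Rsupp(c): the K-row space of the coordinate matrix of c, i.e. the set of all
(phi c_1, ..., phi c_d) for phi a K-linear form L -> K (the rows are the coordinate forms
applied to c, and their K-linear combinations are exactly the K-linear forms).\<close>
definition Rsupp :: "('k::field \<Rightarrow> 'l::field) \<Rightarrow> (nat \<Rightarrow> 'l) \<Rightarrow> (nat \<Rightarrow> 'k) set" where
  "Rsupp emb c = {(\<lambda>j. \<phi> (c j)) | \<phi>. Vector_Spaces.linear (esc emb) (*) \<phi>}"

definition wtR :: "('k::field \<Rightarrow> 'l::field) \<Rightarrow> (nat \<Rightarrow> 'l) set \<Rightarrow> nat" where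
  "wtR emb D = vector_space.dim (vsc :: 'k \<Rightarrow> _) (module.span vsc (\<Union>c\<in>D. Rsupp emb c))"

definition gen_rank_weight :: "('k::field \<Rightarrow> 'l::field) \<Rightarrow> (nat \<Rightarrow> 'l) set \<Rightarrow> nat \<Rightarrow> nat" where
  "gen_rank_weight emb C r = (if r = 0 then 0 else
     Inf {wtR emb D | D. module.subspace (vsc :: 'l \<Rightarrow> _) D \<and> D \<subseteq> C \<and> vector_space.dim (vsc :: 'l \<Rightarrow> _) D = r})"

end

theory Submission
  imports Defs
begin

text \<open>
Write \<open>F\<^sub>i = f\<^sub>i ^ m\<^sub>i\<close> and \<open>h\<^sub>i = f / F\<^sub>i\<close>. A cyclic vector identifies \<open>L^n\<close> with \<open>L[x]/(f)\<close>, and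
two families of maps with matrices over K link \<open>C\<^sub>g\<close> to the \<open>C\<^sub>i\<close>: reduction
\<open>B\<^sub>i : P \<mapsto> P mod F\<^sub>i\<close> and multiplication \<open>A\<^sub>i : Q \<mapsto> h\<^sub>i Q\<close>.

A matrix over K commutes with taking rank supports, so rank-nullity over K and over L gives, for
every subcode D, both \<open>wt D \<ge> wt (D \<inter> ker B\<^sub>i) + wt (B\<^sub>i D)\<close> and
\<open>dim D = dim (D \<inter> ker B\<^sub>i) + dim (B\<^sub>i D)\<close>. Peeling off one i after the other distributes \<open>dim D\<close>
over the \<open>C\<^sub>i\<close>, which is the lower bound. For the upper bound take \<open>D = \<Sum> A\<^sub>i D\<^sub>i\<close>: weights are
subadditive and do not grow under \<open>A\<^sub>i\<close>, while dimensions add because \<open>B\<^sub>j A\<^sub>i = 0\<close> for \<open>i \<noteq> j\<close>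
and \<open>B\<^sub>i A\<^sub>i\<close> is injective. Finally, the multiples \<open>g\<^sub>i P\<close> with \<open>deg P < r\<close> form an r-dimensional
subcode of \<open>C\<^sub>i\<close> supported on the first \<open>deg g\<^sub>i + r\<close> coordinates.
\<close>

subsection \<open>Linear algebra\<close>

context vector_space
begin

text \<open>\<open>dim\<close> is the cardinality of a basis and \<open>card\<close> of an infinite
  set is 0, so monotonicity is stated below a finite spanning set.\<close>

lemma dim_mono_finite:
  assumes "V \<subseteq> span W" "W \<subseteq> span B" "finite B"
  shows "dim V \<le> dim W"
proof -
  obtain A where A: "A \<subseteq> W" "independent A" "W \<subseteq> span A" "card A = dim W"
    using basis_exists by blast
  have "finite A"
    using independent_span_bound[OF assms(3) A(2)] A(1) assms(2) by auto
  moreover have "V \<subseteq> span A"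
    using assms(1) A(3) span_minimal[OF A(3) subspace_span] by blast
  ultimately show ?thesis
    using dim_le_card A(4) by metis
qed

lemma dim_Un_le:
  assumes "S \<subseteq> span B" "T \<subseteq> span B" "finite B"
  shows "dim (S \<union> T) \<le> dim S + dim T"
proof -
  obtain A where A: "A \<subseteq> S" "independent A" "S \<subseteq> span A" "card A = dim S"
    using basis_exists by blast
  obtain A' where A': "A' \<subseteq> T" "independent A'" "T \<subseteq> span A'" "card A' = dim T"
    using basis_exists by blast
  have fin: "finite A" "finite A'"
    using independent_span_bound[OF assms(3)] A(1,2) A'(1,2) assms(1,2) by blast+
  have "S \<union> T \<subseteq> span (A \<union> A')"
    using A(3) A'(3) span_mono[of A "A \<union> A'"] span_mono[of A' "A \<union> A'"] by blast
  then have "dim (S \<union> T) \<le> card (A \<union> A')"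
    using dim_le_card fin by blast
  also have "\<dots> \<le> dim S + dim T"
    using card_Un_le[of A A'] A(4) A'(4) by simp
  finally show ?thesis .
qed

text \<open>By uniqueness of coordinates, those of \<open>x\<close> over \<open>B\<close> vanish
  both on \<open>B1\<close> and outside it.\<close>

lemma span_disjoint_independent:
  assumes "independent B" "B1 \<subseteq> B" "x \<in> span B1" "x \<in> span (B - B1)"
  shows "x = 0"
proof -
  have "representation B x = representation B1 x" "representation B x = representation (B - B1) x"
    using representation_extend[OF assms(1) assms(3,2)]
      representation_extend[OF assms(1) assms(4)] by auto
  then have "representation B x v = 0" for v
    using representation_ne_zero[of B1 x v] representation_ne_zero[of "B - B1" x v] by auto
  moreover have "x \<in> span B"
    using assms(2,3) span_mono by blast
  ultimately show ?thesis
    using sum_nonzero_representation_eq[OF assms(1)] by force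
qed

end

text \<open>Formulated for a subspace \<open>S\<close> of a finite span because the function spaces
  to which it is applied have infinite dimension. A basis \<open>N\<close> of the kernel extends to
  a basis \<open>A\<close> of \<open>S\<close>, and \<open>F\<close> carries \<open>A - N\<close>
  bijectively to a basis of the image.\<close>

lemma (in vector_space_pair) rank_nullity:
  assumes lin: "Vector_Spaces.linear s1 s2 F" and S: "vs1.subspace S" and B: "S \<subseteq> vs1.span B" "finite B"
  shows "vs1.dim S = vs1.dim {x\<in>S. F x = 0} + vs2.dim (F ` S)"
proof -
  interpret F: Vector_Spaces.linear s1 s2 F by fact
  obtain N where N: "N \<subseteq> {x\<in>S. F x = 0}" "vs1.independent N" "{x\<in>S. F x = 0} \<subseteq> vs1.span N"
      "card N = vs1.dim {x\<in>S. F x = 0}"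
    using vs1.basis_exists by blast
  obtain A where A: "N \<subseteq> A" "A \<subseteq> S" "vs1.independent A" "S \<subseteq> vs1.span A"
    using vs1.maximal_independent_subset_extend[of N S] N by blast
  have fin: "finite A"
    using vs1.independent_span_bound[OF B(2) A(3)] A(2) B(1) by blast
  have spA: "vs1.span A = S"
    using A S vs1.span_minimal by blast
  have inj: "inj_on F (vs1.span (A - N))"
  proof (rule F.inj_on_iff_eq_0[THEN iffD2])
    show "vs1.subspace (vs1.span (A - N))" by simp
    show "\<forall>x\<in>vs1.span (A - N). F x = 0 \<longrightarrow> x = 0"
    proof safe
      fix x assume x: "x \<in> vs1.span (A - N)" "F x = 0"
      then have "x \<in> S" using spA vs1.span_mono[of "A - N" A] by blast
      then have "x \<in> vs1.span N" using x N(3) by blast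
      then show "x = 0" using vs1.span_disjoint_independent[OF A(3,1)] x(1) by blast
    qed
  qed
  have "vs1.independent (A - N)"
    using A(3) vs1.independent_mono by blast
  then have ind: "vs2.independent (F ` (A - N))"
    using F.independent_injective_image inj by blast
  have sub: "F ` S \<subseteq> vs2.span (F ` (A - N))"
  proof -
    \<comment> \<open>\<open>F\<close> kills \<open>N\<close>, so passing from \<open>A - N\<close>
      to \<open>A\<close> adds at most 0 to the image.\<close>
    have "F ` A \<subseteq> insert 0 (F ` (A - N))" using N(1) by auto
    then have "vs2.span (F ` A) \<subseteq> vs2.span (F ` (A - N))"
      using vs2.span_mono vs2.span_insert_0 by metis
    then show ?thesis using F.span_image spA by simp
  qed
  have "vs2.dim (F ` S) = card (F ` (A - N))"
    by (rule vs2.basis_card_eq_dim[OF image_mono sub ind, symmetric]) (use A(2) in blast)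
  also have "\<dots> = card (A - N)"
    by (meson card_image inj inj_on_subset vs1.span_superset)
  also have "\<dots> = card A - card N"
    by (meson A(1) card_Diff_subset fin finite_subset)
  finally have "vs2.dim (F ` S) = card A - card N" .
  moreover have "card A = vs1.dim S"
    using vs1.basis_card_eq_dim A by blast
  moreover have "card N \<le> card A"
    using A(1) fin card_mono by blast
  ultimately show ?thesis using N(4) by simp
qed

section \<open>Vectors of finite length, matrices acting on them, and rank supports\<close>

lemma vector_space_vsc: "vector_space (vsc :: 'a::field \<Rightarrow> (nat \<Rightarrow> 'a) \<Rightarrow> nat \<Rightarrow> 'a)"
  by standard (auto simp: vsc_def fun_eq_iff algebra_simps)

interpretation vsc: vector_space "vsc :: 'a::field \<Rightarrow> (nat \<Rightarrow> 'a) \<Rightarrow> nat \<Rightarrow> 'a"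
  by (rule vector_space_vsc)

interpretation vsc: vector_space_pair "vsc :: 'a::field \<Rightarrow> (nat \<Rightarrow> 'a) \<Rightarrow> nat \<Rightarrow> 'a" "vsc :: 'a \<Rightarrow> (nat \<Rightarrow> 'a) \<Rightarrow> nat \<Rightarrow> 'a"
  by unfold_locales

abbreviation lin :: "((nat \<Rightarrow> 'a::field) \<Rightarrow> nat \<Rightarrow> 'a) \<Rightarrow> bool" where
  "lin \<equiv> Vector_Spaces.linear vsc vsc"

lemma vsc_apply [simp]: "vsc a v j = a * v j"
  by (simp add: vsc_def)

lemma sum_fun_apply: "(\<Sum>i\<in>I. F i) x = (\<Sum>i\<in>I. F i x)"
  by (induction I rule: infinite_finite_induct) auto

definition unitv :: "nat \<Rightarrow> nat \<Rightarrow> 'a::zero_neq_one" where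
  "unitv i = (\<lambda>j. if j = i then 1 else 0)"

lemma unitv_in_vecs [simp]: "i < d \<Longrightarrow> unitv i \<in> vecs d"
  by (auto simp: unitv_def vecs_def)

lemma subspace_vecs [simp]: "vsc.subspace (vecs d)"
  by (auto simp: vsc.subspace_def vecs_def)

lemma vecs_decompose:
  assumes "c \<in> vecs d"
  shows "c = (\<Sum>j<d. vsc (c j) (unitv j))"
  using assms by (auto simp: fun_eq_iff sum_fun_apply unitv_def vecs_def if_distrib sum.delta cong: if_cong)

lemma vecs_subset_span: "vecs d \<subseteq> vsc.span (unitv ` {..<d})"
proof
  fix c :: "nat \<Rightarrow> 'a" assume "c \<in> vecs d"
  then have "c = (\<Sum>j<d. vsc (c j) (unitv j))" by (rule vecs_decompose)
  also have "\<dots> \<in> vsc.span (unitv ` {..<d})"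
    by (intro vsc.span_sum vsc.span_scale vsc.span_base) auto
  finally show "c \<in> vsc.span (unitv ` {..<d})" .
qed

lemma dim_vecs_mono:
  assumes "S \<subseteq> T" "T \<subseteq> vecs d"
  shows "vsc.dim S \<le> vsc.dim T"
  using vsc.dim_mono_finite[of S T "unitv ` {..<d}"] assms vecs_subset_span[of d] vsc.span_superset[of T] by blast

lemma dim_le_vecs:
  assumes "S \<subseteq> vecs d"
  shows "vsc.dim S \<le> d"
proof -
  have "vsc.dim S \<le> card (unitv ` {..<d} :: (nat \<Rightarrow> 'a) set)"
    using vsc.dim_le_card assms vecs_subset_span by blast
  also have "\<dots> \<le> d"
    using card_image_le[of "{..<d}"] by auto
  finally show ?thesis .
qed

lemma rank_nullity_vecs:
  assumes "lin F" "vsc.subspace S" "S \<subseteq> vecs d"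
  shows "vsc.dim S = vsc.dim {x\<in>S. F x = 0} + vsc.dim (F ` S)"
  using vsc.rank_nullity[OF assms(1,2), of "unitv ` {..<d}"] assms(3) vecs_subset_span[of d] by blast

lemma dim_zero [simp]: "vsc.dim {0::nat \<Rightarrow> 'a::field} = 0"
  using dim_le_vecs[of "{0::nat \<Rightarrow> 'a}" 0] by (simp add: vecs_def)

lemma dim_inj_image_vecs:
  assumes "lin F" "vsc.subspace S" "S \<subseteq> vecs d" "\<And>x. x \<in> S \<Longrightarrow> F x = 0 \<Longrightarrow> x = 0"
  shows "vsc.dim (F ` S) = vsc.dim S"
proof -
  have "0 \<in> S" using assms(2) by (rule vsc.subspace_0)
  moreover have "F 0 = 0" using assms(1) by (rule vsc.linear_0)
  ultimately have "{x\<in>S. F x = 0} = {0}" using assms(4) by auto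
  then show ?thesis using rank_nullity_vecs[OF assms(1-3)] by simp
qed

text \<open>Unlike for \<open>mat_vec\<close>, the matrix may be rectangular: \<open>d\<close>
  counts its columns and the rows are not truncated. This suits maps between the code length
  \<open>n\<close> and the lengths of the components.\<close>

definition mat_act :: "nat \<Rightarrow> (nat \<Rightarrow> nat \<Rightarrow> 'a::field) \<Rightarrow> (nat \<Rightarrow> 'a) \<Rightarrow> nat \<Rightarrow> 'a" where
  "mat_act d A c = (\<lambda>i. \<Sum>j<d. A i j * c j)"

lemma lin_iff: "lin F \<longleftrightarrow> (\<forall>x y. F (x + y) = F x + F y) \<and> (\<forall>a x. F (vsc a x) = vsc a (F x))"
  by (simp add: Vector_Spaces.linear_iff vector_space_vsc)

lemma lin_mat_act: "lin (mat_act d A)"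
  by (auto simp: lin_iff mat_act_def fun_eq_iff algebra_simps sum.distrib sum_distrib_left)

lemma lin_mat_vec: "lin (mat_vec n A)"
  by (auto simp: lin_iff mat_vec_def fun_eq_iff algebra_simps sum.distrib sum_distrib_left)

text \<open>A K-linear form pulls out the scalars \<open>emb (A i j)\<close>, so it commutes with a
  matrix over K. This is why all maps between the codes are given by matrices over K.\<close>

lemma Rsupp_mat_act:
  "Rsupp emb (mat_act d (\<lambda>i j. emb (A i j)) c) = mat_act d A ` Rsupp emb c"
proof -
  have "(\<lambda>i. \<phi> (mat_act d (\<lambda>i j. emb (A i j)) c i)) = mat_act d A (\<lambda>j. \<phi> (c j))"
    if lin: "Vector_Spaces.linear (esc emb) (*) \<phi>" for \<phi>
  proof -
    interpret \<phi>: Vector_Spaces.linear "esc emb" "(*)" \<phi> by (rule lin)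
    have "\<phi> (emb a * x) = a * \<phi> x" for a x
      using \<phi>.scale[of a x] by (simp add: esc_def)
    then show ?thesis by (simp add: mat_act_def \<phi>.sum)
  qed
  then show ?thesis unfolding Rsupp_def by (auto simp: image_iff; metis)
qed

lemma Rsupp_vecs: "c \<in> vecs d \<Longrightarrow> Rsupp emb c \<subseteq> vecs d"
proof -
  have "\<phi> 0 = 0" if "Vector_Spaces.linear (esc emb) (*) \<phi>" for \<phi>
    using Vector_Spaces.linear.axioms(3)[OF that] by (rule module_hom.zero)
  then show "c \<in> vecs d \<Longrightarrow> Rsupp emb c \<subseteq> vecs d"
    by (auto simp: Rsupp_def vecs_def)
qed

lemma Rsupp_add: "x \<in> Rsupp emb (c + c') \<Longrightarrow> \<exists>y\<in>Rsupp emb c. \<exists>z\<in>Rsupp emb c'. x = y + z"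
proof -
  assume "x \<in> Rsupp emb (c + c')"
  then obtain \<phi> where \<phi>: "Vector_Spaces.linear (esc emb) (*) \<phi>" "x = (\<lambda>j. \<phi> ((c + c') j))"
    by (auto simp: Rsupp_def)
  interpret \<phi>: Vector_Spaces.linear "esc emb" "(*)" \<phi> by (rule \<phi>)
  have "x = (\<lambda>j. \<phi> (c j)) + (\<lambda>j. \<phi> (c' j))"
    using \<phi>(2) by (auto simp: fun_eq_iff \<phi>.add)
  then show ?thesis using \<phi>(1) by (auto simp: Rsupp_def)
qed

text \<open>The space behind \<open>wtR\<close>; arguments with kernels and images need the space
  and not only its dimension.\<close>

definition Rspan :: "('k::field \<Rightarrow> 'l::field) \<Rightarrow> (nat \<Rightarrow> 'l) set \<Rightarrow> (nat \<Rightarrow> 'k) set" where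
  "Rspan emb D = vsc.span (\<Union>c\<in>D. Rsupp emb c)"

lemma wtR_Rspan: "wtR emb D = vsc.dim (Rspan emb D)"
  by (simp add: wtR_def Rspan_def)

lemma Rsupp_subset_Rspan: "c \<in> D \<Longrightarrow> Rsupp emb c \<subseteq> Rspan emb D"
  using vsc.span_superset unfolding Rspan_def by blast

lemma subspace_Rspan [simp]: "vsc.subspace (Rspan emb D)"
  by (simp add: Rspan_def)

lemma Rspan_least: "(\<And>c. c \<in> D \<Longrightarrow> Rsupp emb c \<subseteq> S) \<Longrightarrow> vsc.subspace S \<Longrightarrow> Rspan emb D \<subseteq> S"
  unfolding Rspan_def by (rule vsc.span_minimal) auto

lemma Rspan_vecs: "D \<subseteq> vecs d \<Longrightarrow> Rspan emb D \<subseteq> vecs d"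
  by (intro Rspan_least Rsupp_vecs) auto

lemma Rspan_mat_act:
  "Rspan emb (mat_act d (\<lambda>i j. emb (A i j)) ` D) = mat_act d A ` Rspan emb D"
proof -
  interpret Vector_Spaces.linear vsc vsc "mat_act d A" by (rule lin_mat_act)
  show ?thesis by (simp add: Rspan_def Rsupp_mat_act flip: span_image image_UN)
qed

lemma wtR_le: "D \<subseteq> vecs d \<Longrightarrow> wtR emb D \<le> d"
  by (simp add: wtR_Rspan dim_le_vecs Rspan_vecs)

lemma wtR_zero [simp]: "wtR emb {0} = 0"
  using wtR_le[of "{0}" 0 emb] by (simp add: vecs_def)

lemma wtR_image_le:
  assumes "D \<subseteq> vecs e"
  shows "wtR emb (mat_act d (\<lambda>i j. emb (A i j)) ` D) \<le> wtR emb D"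
  using rank_nullity_vecs[OF lin_mat_act[of d A] subspace_Rspan Rspan_vecs[OF assms, of emb]]
  by (simp add: wtR_Rspan Rspan_mat_act)

text \<open>Rank-nullity is applied to \<open>A\<close> on the row space \<open>Rspan emb D\<close>,
  whose image is the row space of the image code. Its kernel contains, possibly strictly, the row
  space of the codewords killed by \<open>A\<close>, hence only an inequality.\<close>

lemma wtR_kernel_image:
  assumes "D \<subseteq> vecs e"
  shows "wtR emb {c\<in>D. mat_act d (\<lambda>i j. emb (A i j)) c = 0}
       + wtR emb (mat_act d (\<lambda>i j. emb (A i j)) ` D) \<le> wtR emb D"
proof -
  let ?N = "{c\<in>D. mat_act d (\<lambda>i j. emb (A i j)) c = 0}"
  let ?NK = "{w\<in>Rspan emb D. mat_act d A w = 0}"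
  have z: "Rsupp emb 0 \<subseteq> {0}"
    using Rsupp_vecs[of 0 0 emb] by (auto simp: vecs_def fun_eq_iff)
  have "Rspan emb ?N \<subseteq> ?NK"
  proof (rule Rspan_least)
    fix c assume c: "c \<in> ?N"
    \<comment> \<open>\<open>c\<close> is mapped to 0, and the support of 0 is trivial.\<close>
    have "mat_act d A ` Rsupp emb c \<subseteq> {0}"
      using z c by (simp flip: Rsupp_mat_act)
    then show "Rsupp emb c \<subseteq> ?NK" using Rsupp_subset_Rspan[of c D emb] c by auto
  next
    interpret Vector_Spaces.linear vsc vsc "mat_act d A" by (rule lin_mat_act)
    show "vsc.subspace ?NK"
      using subspace_Rspan[of emb D] by (auto simp: vsc.subspace_def zero add scale)
  qed
  moreover have "?NK \<subseteq> vecs e" using Rspan_vecs[OF assms] by auto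
  ultimately have "wtR emb ?N \<le> vsc.dim ?NK"
    by (simp add: wtR_Rspan dim_vecs_mono)
  then show ?thesis
    using rank_nullity_vecs[OF lin_mat_act[of d A] subspace_Rspan Rspan_vecs[OF assms, of emb]]
    by (simp add: wtR_Rspan Rspan_mat_act)
qed

text \<open>By \<open>Rsupp_add\<close> the supports of sums lie in the span of both row spaces, and
  dimension is subadditive.\<close>

lemma wtR_add_le:
  assumes "D \<subseteq> vecs e" "D' \<subseteq> vecs e"
  shows "wtR emb {c + c' | c c'. c \<in> D \<and> c' \<in> D'} \<le> wtR emb D + wtR emb D'"
proof -
  let ?S = "vsc.span (Rspan emb D \<union> Rspan emb D')"
  have "Rspan emb {c + c' | c c'. c \<in> D \<and> c' \<in> D'} \<subseteq> ?S"
  proof (rule Rspan_least)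
    fix c assume "c \<in> {c + c' | c c'. c \<in> D \<and> c' \<in> D'}"
    then obtain a b where "c = a + b" "a \<in> D" "b \<in> D'" by auto
    then show "Rsupp emb c \<subseteq> ?S"
      using Rsupp_subset_Rspan[of a D emb] Rsupp_subset_Rspan[of b D' emb] vsc.span_superset[of "Rspan emb D \<union> Rspan emb D'"]
      by (auto dest!: Rsupp_add intro!: vsc.span_add)
  qed simp
  moreover have "?S \<subseteq> vecs e"
    using Rspan_vecs[OF assms(1)] Rspan_vecs[OF assms(2)] by (intro vsc.span_minimal) auto
  ultimately have "wtR emb {c + c' | c c'. c \<in> D \<and> c' \<in> D'} \<le> vsc.dim ?S"
    unfolding wtR_Rspan by (rule dim_vecs_mono)
  also have "\<dots> \<le> vsc.dim (Rspan emb D) + vsc.dim (Rspan emb D')"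
    using vsc.dim_Un_le[of "Rspan emb D" "unitv ` {..<e}" "Rspan emb D'"] vecs_subset_span[of e]
      Rspan_vecs[OF assms(1)] Rspan_vecs[OF assms(2)] by (simp; blast)
  finally show ?thesis by (simp add: wtR_Rspan)
qed

section \<open>Polynomials and their coefficient vectors\<close>

lemma coeff_in_vecs_iff: "coeff p \<in> vecs d \<longleftrightarrow> p = 0 \<or> degree p < d"
proof
  assume *: "coeff p \<in> vecs d"
  show "p = 0 \<or> degree p < d"
  proof (rule ccontr)
    assume "\<not> (p = 0 \<or> degree p < d)"
    then have "p \<noteq> 0" "lead_coeff p = 0" using * by (auto simp: vecs_def)
    then show False by simp
  qed
qed (auto simp: vecs_def coeff_eq_0)

text \<open>The degree bound is put as membership in \<open>vecs\<close>, so that the remainder 0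
  modulo a constant is covered too.\<close>

lemma poly_mod_unique:
  fixes q :: "'a::field poly"
  assumes "coeff r \<in> vecs (degree q)" "q dvd p - r"
  shows "p mod q = r"
proof -
  have "r mod q = r" using assms(1) by (auto simp: coeff_in_vecs_iff mod_poly_less)
  moreover have "p mod q = r mod q" using assms(2) by (simp add: mod_eq_dvd_iff)
  ultimately show ?thesis by simp
qed

lemma coeff_mod_in_vecs:
  fixes q :: "'a::field poly"
  assumes "q \<noteq> 0"
  shows "coeff (p mod q) \<in> vecs (degree q)"
  using degree_mod_less[OF assms, of p] by (auto simp: coeff_in_vecs_iff)

lemma coeff_add_fun: "coeff (p + q) = coeff p + coeff q"
  by (simp add: fun_eq_iff)

lemma coeff_smult_fun: "coeff (smult a p) = vsc a (coeff p)"
  by (simp add: fun_eq_iff)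

lemma coeff_0_fun [simp]: "coeff 0 = 0"
  by (simp add: fun_eq_iff)

lemma coeff_eq_0_fun_iff: "coeff p = 0 \<longleftrightarrow> p = 0"
  by (simp add: fun_eq_iff poly_eq_iff)

lemma smult_sum_right: "smult a (\<Sum>i\<in>I. p i) = (\<Sum>i\<in>I. smult a (p i))"
  by (induction I rule: infinite_finite_induct) (auto simp: smult_add_right)

lemma poly_mod_sum: "(\<Sum>i\<in>I. p i) mod q = (\<Sum>i\<in>I. p i mod (q :: 'a::field poly))"
  by (induction I rule: infinite_finite_induct) (auto simp: poly_mod_add_left)

definition polyv :: "nat \<Rightarrow> (nat \<Rightarrow> 'a::comm_monoid_add) \<Rightarrow> 'a poly" where
  "polyv d c = (\<Sum>i<d. monom (c i) i)"

lemma coeff_polyv: "coeff (polyv d c) i = (if i < d then c i else 0)"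
  by (simp add: polyv_def coeff_sum if_distrib sum.delta cong: if_cong)

lemma coeff_polyv_vecs: "c \<in> vecs d \<Longrightarrow> coeff (polyv d c) = c"
  by (auto simp: fun_eq_iff coeff_polyv vecs_def)

lemma polyv_coeff: "coeff p \<in> vecs d \<Longrightarrow> polyv d (coeff p) = p"
  by (simp add: poly_eq_iff coeff_polyv_vecs)

subsection \<open>Comaximal polynomials\<close>

text \<open>Comaximality is taken as a Bezout identity because such an identity survives the passage
  from K[x] to L[x], where irreducible factors may split further.\<close>

definition comax :: "'a::comm_semiring_1 \<Rightarrow> 'a \<Rightarrow> bool" where
  "comax p q \<longleftrightarrow> (\<exists>a b. a * p + b * q = 1)"

lemma comax_sym: "comax p q \<Longrightarrow> comax q p"
  unfolding comax_def by (metis add.commute)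

text \<open>In the product of the two Bezout identities every term except the multiple of
  \<open>q * r\<close> contains \<open>p\<close>.\<close>

lemma comax_mult:
  fixes p q r :: "'a::comm_ring_1"
  assumes "comax p q" "comax p r"
  shows "comax p (q * r)"
proof -
  obtain a b c e where "a * p + b * q = 1" "c * p + e * r = 1"
    using assms by (auto simp: comax_def)
  then have "(a * p + b * q) * (c * p + e * r) = 1" by simp
  then have "(a * c * p + a * e * r + b * q * c) * p + (b * e) * (q * r) = 1"
    by (simp add: algebra_simps)
  then show ?thesis unfolding comax_def by blast
qed

lemma comax_1 [simp]: "comax (p::'a::comm_ring_1) 1"
  unfolding comax_def by (rule exI[of _ 0], rule exI[of _ 1]) simp

lemma comax_power:
  fixes p q :: "'a::comm_ring_1"
  shows "comax p q \<Longrightarrow> comax p (q ^ m)"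
  by (induction m) (auto intro: comax_mult)

lemma comax_prod:
  fixes p :: "'a::comm_ring_1"
  shows "(\<And>i. i \<in> I \<Longrightarrow> comax p (q i)) \<Longrightarrow> comax p (\<Prod>i\<in>I. q i)"
  by (induction I rule: infinite_finite_induct) (auto intro: comax_mult)

text \<open>After multiplying the Bezout identity by \<open>r\<close>, both summands are multiples
  of \<open>p\<close>.\<close>

lemma comax_dvd_mult:
  fixes p q r :: "'a::comm_ring_1"
  assumes "comax p q" "p dvd q * r"
  shows "p dvd r"
proof -
  obtain a b where "a * p + b * q = 1" using assms by (auto simp: comax_def)
  then have "r = r * (a * p + b * q)" by simp
  also have "\<dots> = r * a * p + b * (q * r)" by (simp add: algebra_simps)
  finally have r: "r = r * a * p + b * (q * r)" .
  show ?thesis by (subst r) (intro dvd_add dvd_mult dvd_refl assms(2))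
qed

text \<open>Once \<open>q i\<close> is divided out of \<open>x\<close>, each remaining
  \<open>q j\<close> still divides the quotient, being comaximal to \<open>q i\<close>.\<close>

lemma comax_prod_dvd:
  fixes x :: "'a::comm_ring_1"
  assumes "finite I" "\<And>i. i \<in> I \<Longrightarrow> q i dvd x"
    and "\<And>i j. i \<in> I \<Longrightarrow> j \<in> I \<Longrightarrow> i \<noteq> j \<Longrightarrow> comax (q i) (q j)"
  shows "(\<Prod>i\<in>I. q i) dvd x"
  using assms
proof (induction I arbitrary: x rule: finite_induct)
  case (insert i I)
  obtain y where y: "x = q i * y" using insert.prems(1)[of i] by (auto elim: dvdE)
  have "(\<Prod>i\<in>I. q i) dvd y"
  proof (rule insert.IH)
    fix j assume j: "j \<in> I"
    then show "q j dvd y"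
      using insert.prems(1)[of j] insert.prems(2)[of j i] insert.hyps comax_dvd_mult y by blast
  qed (use insert.prems in auto)
  then show ?case using y insert.hyps by (simp add: mult_dvd_mono)
qed simp

text \<open>\<open>S\<close> is the ideal generated by \<open>p\<close> and \<open>q\<close>. A
  nonzero element \<open>e\<close> of least degree generates it by division with remainder. As
  \<open>e\<close> divides \<open>p\<close>, it is a unit unless \<open>p\<close> divides
  \<open>q\<close>.\<close>

lemma irreducible_comax:
  fixes p q :: "'a::field poly"
  assumes "irreducible p" "\<not> p dvd q"
  shows "comax p q"
proof -
  define S where "S = {a * p + b * q | a b. True}"
  have "p \<noteq> 0" using assms(1) by auto
  have "1 * p + 0 * q \<in> S" unfolding S_def by blast
  then have pS: "p \<in> S" by simp
  have "0 * p + 1 * q \<in> S" unfolding S_def by blast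
  then have qS: "q \<in> S" by simp
  obtain e where e: "e \<in> S" "e \<noteq> 0" "\<And>x. x \<in> S \<Longrightarrow> x \<noteq> 0 \<Longrightarrow> degree e \<le> degree x"
    using arg_min_natI[of "\<lambda>x. x \<in> S \<and> x \<noteq> 0" p degree]
      arg_min_nat_le[of "\<lambda>x. x \<in> S \<and> x \<noteq> 0" _ degree] pS \<open>p \<noteq> 0\<close> by blast
  have dvd: "e dvd x" if xS: "x \<in> S" for x
  proof -
    obtain a b c g where x: "x = a * p + b * q" and e': "e = c * p + g * q"
      using xS e(1) unfolding S_def by blast
    have "x mod e = x - x div e * e" by (simp add: minus_div_mult_eq_mod)
    also have "\<dots> = (a - x div e * c) * p + (b - x div e * g) * q"
      by (subst (2) e', subst (1) x) (simp add: algebra_simps)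
    finally have "x mod e \<in> S" unfolding S_def by blast
    then have "x mod e = 0" using e degree_mod_less[of e x] by force
    then show ?thesis by auto
  qed
  obtain y where y: "p = e * y" using dvd[OF pS] by (auto elim: dvdE)
  have "is_unit e"
  proof (rule ccontr)
    assume "\<not> is_unit e"
    \<comment> \<open>With \<open>p = e * y\<close> and \<open>y\<close> a unit, \<open>p\<close>
      divides \<open>e\<close>, which divides \<open>q\<close>.\<close>
    then have "is_unit y" using irreducibleD[OF assms(1) y] by blast
    then have "p dvd e" using y by simp
    then show False using dvd[OF qS] assms(2) dvd_trans by blast
  qed
  then obtain u where "1 = e * u" by (auto elim: dvdE)
  moreover obtain c g where "e = c * p + g * q" using e(1) unfolding S_def by blast
  ultimately have "(u * c) * p + (u * g) * q = 1" by (simp add: algebra_simps)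
  then show ?thesis unfolding comax_def by blast
qed

text \<open>Distinct irreducibles could still be associated; being monic excludes this.\<close>

lemma monic_irreducible_comax:
  fixes p q :: "'a::field poly"
  assumes "irreducible p" "irreducible q" "lead_coeff p = 1" "lead_coeff q = 1" "p \<noteq> q"
  shows "comax p q"
proof (rule irreducible_comax)
  show "\<not> p dvd q"
  proof
    assume "p dvd q"
    then obtain u where u: "q = p * u" by (auto elim: dvdE)
    have "\<not> is_unit p" using assms(1) by (simp add: irreducible_not_unit)
    then have "is_unit u" using irreducibleD[OF assms(2) u] by blast
    then obtain c where c: "u = [:c:]" by (auto simp: is_unit_poly_iff)
    have "c = 1" using assms(3,4) u c lead_coeff_mult[of p u] by simp
    then show False using assms(5) u c by simp
  qed
qed fact

subsection \<open>The polynomial action of a matrix\<close>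

text \<open>Makes \<open>vecs n\<close> a module over the polynomial ring in which x acts as
  \<open>A\<close>; a cyclic vector is a generator of this module.\<close>

definition pact :: "nat \<Rightarrow> (nat \<Rightarrow> nat \<Rightarrow> 'a::field) \<Rightarrow> 'a poly \<Rightarrow> (nat \<Rightarrow> 'a) \<Rightarrow> nat \<Rightarrow> 'a" where
  "pact n A P w = mat_vec n (poly_mat n P A) w"

lemma mat_vec_in_vecs [simp]: "mat_vec n A w \<in> vecs n"
  by (simp add: vecs_def mat_vec_def)

lemma pact_in_vecs [simp]: "pact n A P w \<in> vecs n"
  by (simp add: pact_def)

text \<open>The case \<open>t = 0\<close> rests on \<open>w\<close> lying in \<open>vecs n\<close>,
  since \<open>mat_vec\<close> cuts off all entries from \<open>n\<close> on.\<close>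

lemma mat_vec_mpow:
  assumes "w \<in> vecs n"
  shows "mat_vec n (mpow n A t) w = (mat_vec n A ^^ t) w"
proof (induction t)
  case 0
  show ?case using assms
    by (auto simp: mat_vec_def fun_eq_iff vecs_def if_distrib[where f = "\<lambda>x. x * _"] sum.delta cong: if_cong)
next
  case (Suc t)
  have "(\<Sum>j<n. (\<Sum>l<n. A i l * mpow n A t l j) * w j) = (\<Sum>l<n. A i l * (\<Sum>j<n. mpow n A t l j * w j))" for i
    by (simp add: sum_distrib_left sum_distrib_right mult.assoc) (rule sum.swap)
  then have "mat_vec n (mpow n A (Suc t)) w = mat_vec n A (mat_vec n (mpow n A t) w)"
    by (simp add: mat_vec_def fun_eq_iff)
  then show ?case using Suc by simp
qed

text \<open>The free bound \<open>N\<close> lets polynomials of different degrees be summed over a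
  common range.\<close>

lemma pact_eq_sum:
  assumes "w \<in> vecs n" "degree P \<le> N"
  shows "pact n A P w = (\<Sum>t\<le>N. vsc (coeff P t) ((mat_vec n A ^^ t) w))"
proof
  fix i
  have "pact n A P w i = (\<Sum>t\<le>degree P. coeff P t * mat_vec n (mpow n A t) w i)"
  proof (cases "i < n")
    case True
    then show ?thesis
      by (simp add: pact_def mat_vec_def poly_mat_def sum_distrib_left sum_distrib_right mult.assoc) (rule sum.swap)
  qed (simp add: pact_def mat_vec_def)
  also have "\<dots> = (\<Sum>t\<le>N. coeff P t * mat_vec n (mpow n A t) w i)"
    using assms(2) by (intro sum.mono_neutral_left) (auto simp: coeff_eq_0)
  finally show "pact n A P w i = (\<Sum>t\<le>N. vsc (coeff P t) ((mat_vec n A ^^ t) w)) i"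
    by (simp add: sum_fun_apply mat_vec_mpow assms(1))
qed

lemma pact_add:
  assumes "w \<in> vecs n"
  shows "pact n A (P + Q) w = pact n A P w + pact n A Q w"
proof -
  let ?N = "max (degree P) (degree Q)"
  show ?thesis
    using pact_eq_sum[OF assms, of P ?N A] pact_eq_sum[OF assms, of Q ?N A] pact_eq_sum[OF assms degree_add_le_max, of A P Q]
    by (simp add: vsc.scale_left_distrib sum.distrib)
qed

lemma pact_smult:
  assumes "w \<in> vecs n"
  shows "pact n A (smult a P) w = vsc a (pact n A P w)"
  using pact_eq_sum[OF assms, of P "degree P" A] pact_eq_sum[OF assms degree_smult_le, of A a P]
  by (simp add: vsc.scale_sum_right)

lemma pact_0 [simp]: "w \<in> vecs n \<Longrightarrow> pact n A 0 w = 0"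
  using pact_smult[of w n A 0 0] by simp

lemma pact_diff:
  assumes "w \<in> vecs n"
  shows "pact n A (P - Q) w = pact n A P w - pact n A Q w"
  using pact_add[OF assms, of A "P - Q" Q] by (simp add: eq_diff_eq)

lemma pact_sum:
  assumes "w \<in> vecs n"
  shows "pact n A (\<Sum>i\<in>I. P i) w = (\<Sum>i\<in>I. pact n A (P i) w)"
  by (induction I rule: infinite_finite_induct) (auto simp: pact_add assms)

text \<open>The Horner step, which drives the later inductions over polynomials.\<close>

lemma pact_pCons:
  assumes "w \<in> vecs n"
  shows "pact n A (pCons a P) w = vsc a w + mat_vec n A (pact n A P w)"
proof -
  interpret T: Vector_Spaces.linear vsc vsc "mat_vec n A" by (rule lin_mat_vec)
  have "pact n A (pCons a P) w = (\<Sum>t\<le>Suc (degree P). vsc (coeff (pCons a P) t) ((mat_vec n A ^^ t) w))"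
    using assms degree_pCons_le by (rule pact_eq_sum)
  also have "\<dots> = vsc a w + (\<Sum>t\<le>degree P. vsc (coeff P t) (mat_vec n A ((mat_vec n A ^^ t) w)))"
    by (simp only: sum.atMost_Suc_shift) simp
  also have "\<dots> = vsc a w + mat_vec n A (pact n A P w)"
    by (simp add: pact_eq_sum[OF assms order_refl] T.sum T.scale)
  finally show ?thesis .
qed

lemma lin_pact: "lin (pact n A P)"
  unfolding pact_def by (rule lin_mat_vec)

lemma pact_mult:
  assumes "w \<in> vecs n"
  shows "pact n A (P * Q) w = pact n A P (pact n A Q w)"
proof (induction P)
  case (pCons a P)
  have "pact n A (pCons a P * Q) w = pact n A (smult a Q) w + pact n A (pCons 0 (P * Q)) w"
    by (simp add: pact_add assms)
  also have "\<dots> = vsc a (pact n A Q w) + mat_vec n A (pact n A P (pact n A Q w))"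
    by (simp add: pact_smult pact_pCons assms pCons.IH)
  finally show ?case by (simp add: pact_pCons)
qed (simp add: assms)

lemma pact_polyv:
  assumes "v \<in> vecs n"
  shows "pact n A (polyv n a) v j = (\<Sum>i<n. a i * mat_vec n (mpow n A i) v j)"
proof -
  have "degree (polyv n a) \<le> n"
    by (rule degree_le) (simp add: coeff_polyv)
  then have "pact n A (polyv n a) v j = (\<Sum>t\<le>n. coeff (polyv n a) t * (mat_vec n A ^^ t) v j)"
    by (simp add: pact_eq_sum assms sum_fun_apply)
  also have "\<dots> = (\<Sum>t<n. coeff (polyv n a) t * (mat_vec n A ^^ t) v j)"
    by (intro sum.mono_neutral_right) (auto simp: coeff_polyv)
  finally show ?thesis by (simp add: coeff_polyv mat_vec_mpow assms)
qed

text \<open>Coordinates with respect to the iterates of \<open>v\<close> are the coefficients of a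
  polynomial of degree below \<open>n\<close>, so the basis condition is unique representability by
  such a polynomial.\<close>

lemma cyclic_vec_iff:
  "cyclic_vec n A v \<longleftrightarrow>
     v \<in> vecs n \<and> (\<forall>w\<in>vecs n. \<exists>!P. coeff P \<in> vecs n \<and> pact n A P v = w)"
proof -
  have "(\<exists>!a. a \<in> vecs n \<and> (\<forall>j. w j = (\<Sum>i<n. a i * mat_vec n (mpow n A i) v j)))
      \<longleftrightarrow> (\<exists>!P. coeff P \<in> vecs n \<and> pact n A P v = w)"
    if v: "v \<in> vecs n" for w
  proof -
    define X where "X = (\<lambda>a. a \<in> vecs n \<and> (\<forall>j. w j = (\<Sum>i<n. a i * mat_vec n (mpow n A i) v j)))"
    define Y where "Y = (\<lambda>P. coeff P \<in> vecs n \<and> pact n A P v = w)"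
    \<comment> \<open>\<open>polyv n\<close> and \<open>coeff\<close> are mutually inverse between
      the solutions of \<open>X\<close> and those of \<open>Y\<close>.\<close>
    have XY: "Y (polyv n a)" "coeff (polyv n a) = a" if "X a" for a
      using that by (auto simp: X_def Y_def coeff_polyv_vecs fun_eq_iff pact_polyv v)
    have YX: "X (coeff P)" "polyv n (coeff P) = P" if "Y P" for P
      using that pact_polyv[OF v, of A "coeff P"] by (auto simp: X_def Y_def polyv_coeff)
    have "(\<exists>!a. X a) \<longleftrightarrow> (\<exists>!P. Y P)"
      using XY YX by metis
    then show ?thesis by (simp only: X_def Y_def)
  qed
  then show ?thesis unfolding cyclic_vec_def by (intro conj_cong refl ball_cong) simp
qed

lemma annihilates_iff:
  "annihilates n P A \<longleftrightarrow> (\<forall>w\<in>vecs n. pact n A P w = 0)"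
proof
  assume "annihilates n P A"
  then show "\<forall>w\<in>vecs n. pact n A P w = 0"
    by (auto simp: annihilates_def pact_def mat_vec_def fun_eq_iff)
next
  assume *: "\<forall>w\<in>vecs n. pact n A P w = 0"
  show "annihilates n P A" unfolding annihilates_def
  proof (intro allI impI)
    fix i j assume ij: "i < n" "j < n"
    then have "pact n A P (unitv j) i = 0" using * by simp
    then show "poly_mat n P A i j = 0"
      using ij by (simp add: pact_def mat_vec_def unitv_def if_distrib sum.delta cong: if_cong)
  qed
qed

lemma cyclic_vec_inj:
  assumes "cyclic_vec n A v" "coeff P \<in> vecs n" "pact n A P v = 0"
  shows "P = 0"
proof -
  have v: "v \<in> vecs n" using assms(1) by (simp add: cyclic_vec_iff)
  have "\<exists>!P. coeff P \<in> vecs n \<and> pact n A P v = 0"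
    using assms(1) pact_in_vecs[of n A P v] assms(3) by (simp add: cyclic_vec_iff)
  moreover have "coeff 0 \<in> vecs n \<and> pact n A 0 v = 0" using v by (simp add: vecs_def)
  ultimately show ?thesis using assms(2,3) by blast
qed

text \<open>A polynomial of degree below \<open>n\<close> that kills \<open>v\<close> is 0, so
  \<open>degree f\<close> is at least \<open>n\<close>. Conversely, expressing the
  \<open>n\<close>-th iterate of \<open>v\<close> by the lower ones gives a monic polynomial of
  degree \<open>n\<close> that kills \<open>v\<close>, and hence every vector.\<close>

lemma min_poly_cyclic:
  assumes cyc: "cyclic_vec n A v" and f: "is_min_poly n A f"
  shows "degree f = n" "pact n A f v = 0"
proof -
  have v: "v \<in> vecs n" using cyc by (simp add: cyclic_vec_iff)
  have f0: "f \<noteq> 0" using f by (auto simp: is_min_poly_def)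
  show fv: "pact n A f v = 0" using f v by (simp add: is_min_poly_def annihilates_iff)
  have "degree f \<ge> n"
    using cyclic_vec_inj[OF cyc _ fv] f0 by (force simp: coeff_in_vecs_iff)
  moreover have "degree f \<le> n"
  proof -
    obtain R where R: "coeff R \<in> vecs n" "pact n A R v = pact n A (monom 1 n) v"
      using cyc pact_in_vecs[of n A "monom 1 n" v] unfolding cyclic_vec_iff by blast
    let ?q = "monom 1 n - R"
    have q: "coeff ?q n = 1" using R(1) by (simp add: vecs_def)
    then have q0: "?q \<noteq> 0" by (metis coeff_0 zero_neq_one)
    have dq: "degree ?q \<le> n"
      using R(1) by (intro degree_le) (auto simp: vecs_def)
    have qv: "pact n A ?q v = 0" by (simp add: pact_diff v R(2))
    have "annihilates n ?q A" unfolding annihilates_iff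
    proof
      fix w :: "nat \<Rightarrow> 'a" assume "w \<in> vecs n"
      then obtain P where P: "w = pact n A P v" using cyc unfolding cyclic_vec_iff by blast
      \<comment> \<open>Polynomials in \<open>A\<close> commute, so \<open>?q\<close> can be applied
        to \<open>v\<close> first.\<close>
      have "pact n A ?q w = pact n A (P * ?q) v" using v by (simp add: P mult.commute flip: pact_mult)
      also have "\<dots> = pact n A P 0" using v by (simp add: pact_mult qv)
      also have "\<dots> = 0" using lin_pact by (rule vsc.linear_0)
      finally show "pact n A ?q w = 0" .
    qed
    then have "degree f \<le> degree ?q" using f q0 unfolding is_min_poly_def by blast
    then show ?thesis using dq by simp
  qed
  ultimately show "degree f = n" by simp
qed

subsection \<open>Companion matrices\<close>

text \<open>The subdiagonal shifts the coefficients, and the last column replaces x^d by its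
  remainder modulo \<Theta>.\<close>

lemma mat_vec_companion:
  fixes \<Theta> :: "'a::field poly"
  assumes mon: "lead_coeff \<Theta> = 1" and d: "degree \<Theta> = d" "0 < d" and p: "coeff p \<in> vecs d"
  shows "mat_vec d (companion \<Theta>) (coeff p) = coeff (pCons 0 p mod \<Theta>)"
proof -
  \<comment> \<open>As \<Theta> is monic, this multiple of it cancels the coefficient of x^d, so
    \<open>?r\<close> is the remainder.\<close>
  let ?r = "pCons 0 p - smult (coeff p (d - 1)) \<Theta>"
  have T0: "\<Theta> \<noteq> 0" using mon by auto
  have "coeff ?r i = 0" if "i \<ge> d" for i
  proof (cases "i = d")
    case True
    then show ?thesis using mon d by (cases d) auto
  next
    case False
    then have "i > d" using that by simp
    then show ?thesis using p d by (cases i) (auto simp: vecs_def coeff_eq_0)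
  qed
  then have "coeff ?r \<in> vecs d" by (simp add: vecs_def)
  then have mod: "pCons 0 p mod \<Theta> = ?r"
    using T0 d by (intro poly_mod_unique) (auto simp: dvd_smult)
  show ?thesis
  proof
    fix i
    show "mat_vec d (companion \<Theta>) (coeff p) i = coeff (pCons 0 p mod \<Theta>) i"
    proof (cases "i < d")
      case False
      then show ?thesis using coeff_mod_in_vecs[OF T0, of "pCons 0 p"] d by (simp add: mat_vec_def vecs_def)
    next
      case True
      \<comment> \<open>The last column and the subdiagonal do not overlap: for \<open>i < d\<close>
        the second summand vanishes at \<open>j = d - 1\<close>.\<close>
      have "(\<Sum>j<d. companion \<Theta> i j * coeff p j)
          = (\<Sum>j<d. (if j = d - 1 then - coeff \<Theta> i * coeff p j else 0) + (if i = j + 1 then coeff p j else 0))"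
        using True d by (intro sum.cong) (auto simp: companion_def)
      also have "\<dots> = - coeff \<Theta> i * coeff p (d - 1) + (\<Sum>j<d. if i = j + 1 then coeff p j else 0)"
        using d by (simp add: sum.distrib sum.delta)
      also have "(\<Sum>j<d. if i = j + 1 then coeff p j else 0) = coeff (pCons 0 p) i"
        using True by (cases i) (auto simp: sum.delta)
      finally show ?thesis using True by (simp add: mat_vec_def mod)
    qed
  qed
qed

text \<open>By Horner steps from \<open>mat_vec_companion\<close>; the module of the companion
  matrix is the quotient ring modulo \<Theta>.\<close>

lemma pact_companion:
  fixes \<Theta> :: "'a::field poly"
  assumes mon: "lead_coeff \<Theta> = 1" and d: "degree \<Theta> = d" "0 < d" and u: "coeff u \<in> vecs d"
  shows "pact d (companion \<Theta>) P (coeff u) = coeff (P * u mod \<Theta>)"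
proof (induction P)
  case 0
  then show ?case using u by simp
next
  case (pCons a P)
  have T0: "\<Theta> \<noteq> 0" using mon by auto
  have u': "u mod \<Theta> = u" using u d by (auto simp: coeff_in_vecs_iff mod_poly_less)
  have vecs: "coeff (P * u mod \<Theta>) \<in> vecs d" using coeff_mod_in_vecs[OF T0] d by simp
  have m: "pCons 0 (P * u mod \<Theta>) mod \<Theta> = pCons 0 (P * u) mod \<Theta>"
    using mod_mult_right_eq[of "[:0, 1:]" "P * u" \<Theta>] by simp
  have "pact d (companion \<Theta>) (pCons a P) (coeff u)
      = vsc a (coeff u) + mat_vec d (companion \<Theta>) (coeff (P * u mod \<Theta>))"
    by (simp add: pact_pCons u pCons.IH)
  also have "\<dots> = coeff (smult a (u mod \<Theta>) + pCons 0 (P * u) mod \<Theta>)"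
    by (simp add: mat_vec_companion[OF mon d vecs] coeff_add_fun coeff_smult_fun m u')
  also have "smult a (u mod \<Theta>) + pCons 0 (P * u) mod \<Theta> = (pCons a P * u) mod \<Theta>"
    by (simp add: mod_smult_left poly_mod_add_left)
  finally show ?case .
qed

lemma unitv_0_eq_coeff: "unitv 0 = coeff (1 :: 'a::field poly)"
  by (auto simp: fun_eq_iff unitv_def)

text \<open>The class of 1 generates the quotient ring modulo \<Theta>, and its coefficient vector
  is \<open>unitv 0\<close>.\<close>

lemma cyclic_vec_companion:
  fixes \<Theta> :: "'a::field poly"
  assumes mon: "lead_coeff \<Theta> = 1" and d: "degree \<Theta> = d" "0 < d"
  shows "cyclic_vec d (companion \<Theta>) (unitv 0)"
proof -
  have one: "coeff (1 :: 'a poly) \<in> vecs d" using d by (simp add: coeff_in_vecs_iff)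
  have "pact d (companion \<Theta>) P (coeff 1) = coeff P" if "coeff P \<in> vecs d" for P
    using that d by (subst pact_companion[OF mon d one]) (auto simp: coeff_in_vecs_iff mod_poly_less)
  then show ?thesis unfolding cyclic_vec_iff unitv_0_eq_coeff
    using one by (metis coeff_polyv_vecs polyv_coeff)
qed

subsection \<open>Extension of scalars\<close>

locale field_emb =
  fixes emb :: "'k::field \<Rightarrow> 'l::field"
  assumes emb_add: "emb (a + b) = emb a + emb b"
    and emb_mult: "emb (a * b) = emb a * emb b"
    and emb_1 [simp]: "emb 1 = 1"
begin

lemma emb_0 [simp]: "emb 0 = 0"
  using emb_add[of 0 0] by (metis add.right_neutral add_left_cancel)

lemma emb_uminus: "emb (- a) = - emb a"
  using emb_add[of a "- a"] by (simp add: eq_neg_iff_add_eq_0 add.commute)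

lemma emb_sum: "emb (\<Sum>i\<in>I. F i) = (\<Sum>i\<in>I. emb (F i))"
  by (induction I rule: infinite_finite_induct) (auto simp: emb_add)

lemma emb_eq_0_iff [simp]: "emb a = 0 \<longleftrightarrow> a = 0"
proof
  assume "emb a = 0"
  show "a = 0"
  proof (rule ccontr)
    assume "a \<noteq> 0"
    then have "emb a * emb (inverse a) = 1" by (simp flip: emb_mult)
    then show False using \<open>emb a = 0\<close> by simp
  qed
qed simp

abbreviation mp :: "'k poly \<Rightarrow> 'l poly" where "mp \<equiv> map_poly emb"

lemma coeff_mp [simp]: "coeff (mp p) i = emb (coeff p i)"
  by (simp add: coeff_map_poly)

lemma mp_add: "mp (p + q) = mp p + mp q"
  by (simp add: poly_eq_iff emb_add)

lemma mp_diff: "mp (p - q) = mp p - mp q"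
  using mp_add[of "p - q" q] by simp

lemma mp_mult: "mp (p * q) = mp p * mp q"
  by (simp add: poly_eq_iff coeff_mult emb_sum emb_mult)

lemma mp_smult: "mp (smult a p) = smult (emb a) (mp p)"
  by (simp add: poly_eq_iff emb_mult)

lemma mp_monom: "mp (monom a i) = monom (emb a) i"
  by (simp add: map_poly_monom)

lemma mp_sum: "mp (\<Sum>i\<in>I. F i) = (\<Sum>i\<in>I. mp (F i))"
  by (induction I rule: infinite_finite_induct) (auto simp: mp_add)

lemma mp_prod: "mp (\<Prod>i\<in>I. F i) = (\<Prod>i\<in>I. mp (F i))"
  by (induction I rule: infinite_finite_induct) (auto simp: mp_mult)

lemma degree_mp [simp]: "degree (mp p) = degree p"
  by (rule degree_map_poly) simp

lemma mp_eq_0_iff [simp]: "mp p = 0 \<longleftrightarrow> p = 0"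
  by (auto simp: poly_eq_iff)

text \<open>The image of the remainder keeps its degree and its congruence, so uniqueness of
  remainders identifies it.\<close>

lemma mp_mod:
  assumes "q \<noteq> 0"
  shows "mp (p mod q) = mp p mod mp q"
proof (rule poly_mod_unique[symmetric])
  show "coeff (mp (p mod q)) \<in> vecs (degree (mp q))"
    using coeff_mod_in_vecs[OF assms, of p] by (simp add: vecs_def)
  have "mp p - mp (p mod q) = mp q * mp (p div q)"
    by (simp flip: mp_diff mp_mult add: minus_mod_eq_mult_div)
  then show "mp q dvd mp p - mp (p mod q)" by simp
qed

lemma comax_mp: "comax p q \<Longrightarrow> comax (mp p) (mp q)"
  unfolding comax_def by (metis emb_1 map_poly_1' mp_add mp_mult)

abbreviation em :: "(nat \<Rightarrow> nat \<Rightarrow> 'k) \<Rightarrow> nat \<Rightarrow> nat \<Rightarrow> 'l" where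
  "em A \<equiv> (\<lambda>i j. emb (A i j))"

abbreviation ev :: "(nat \<Rightarrow> 'k) \<Rightarrow> nat \<Rightarrow> 'l" where
  "ev w \<equiv> (\<lambda>j. emb (w j))"

lemma ev_in_vecs: "w \<in> vecs n \<Longrightarrow> ev w \<in> vecs n"
  by (simp add: vecs_def)

lemma mat_vec_ev: "mat_vec n (em A) (ev w) = ev (mat_vec n A w)"
  by (simp add: mat_vec_def fun_eq_iff emb_sum emb_mult)

lemma pact_ev:
  assumes "w \<in> vecs n"
  shows "pact n (em A) (mp P) (ev w) = ev (pact n A P w)"
proof (induction P)
  case 0
  show ?case using assms ev_in_vecs[OF assms] by (simp add: fun_eq_iff)
next
  case (pCons a P)
  then show ?case using assms ev_in_vecs[OF assms]
    by (simp add: map_poly_pCons pact_pCons mat_vec_ev) (simp add: fun_eq_iff emb_add emb_mult)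
qed

lemma em_companion: "em (companion \<Theta>) = companion (mp \<Theta>)"
  by (auto simp: companion_def fun_eq_iff emb_uminus)

text \<open>The cyclic vector picked by \<open>cyc_code\<close> is arbitrary. As a class
  \<open>u\<close> modulo \<Theta> it is invertible, since 1 is among its multiples, so it can be
  absorbed into the multiplier \<open>P\<close>.\<close>

lemma poly_code_eq:
  assumes mon: "lead_coeff \<Theta> = 1" and d: "0 < degree \<Theta>"
  shows "poly_code emb \<Theta> g = {coeff (g * P mod mp \<Theta>) | P. True}"
proof -
  define v where "v = (SOME v. cyclic_vec (degree \<Theta>) (companion \<Theta>) v)"
  have cyc: "cyclic_vec (degree \<Theta>) (companion \<Theta>) v"
    unfolding v_def by (rule someI[of "cyclic_vec (degree \<Theta>) (companion \<Theta>)"])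
      (rule cyclic_vec_companion[OF mon refl d])
  then have v: "v \<in> vecs (degree \<Theta>)" by (simp add: cyclic_vec_iff)
  have T0: "\<Theta> \<noteq> 0" using mon by auto
  define u where "u = polyv (degree \<Theta>) v"
  have cu: "coeff u = v" using v by (simp add: u_def coeff_polyv_vecs)
  have evv: "ev v = coeff (mp u)" by (simp add: fun_eq_iff cu)
  have uL: "coeff (mp u) \<in> vecs (degree \<Theta>)" using ev_in_vecs[OF v] evv by simp
  \<comment> \<open>\<open>w\<close> turns out to be the inverse of \<open>u\<close> modulo
    \<Theta>.\<close>
  obtain w where w: "pact (degree \<Theta>) (companion \<Theta>) w v = unitv 0"
    using cyc d unfolding cyclic_vec_iff by (metis unitv_in_vecs)
  have "coeff (w * u mod \<Theta>) = coeff 1"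
    using pact_companion[OF mon refl d, of u w] v cu w by (simp add: unitv_0_eq_coeff)
  then have "w * u mod \<Theta> = 1" by (simp add: coeff_inject)
  then have wu: "mp w * mp u mod mp \<Theta> = 1"
    by (metis T0 emb_1 map_poly_1' mp_mod mp_mult)
  have act: "pact (degree \<Theta>) (em (companion \<Theta>)) P (pact (degree \<Theta>) (em (companion \<Theta>)) g (ev v))
      = coeff (g * (P * mp u) mod mp \<Theta>)" for P
  proof -
    have "pact (degree \<Theta>) (em (companion \<Theta>)) (P * g) (ev v) = coeff (P * g * mp u mod mp \<Theta>)"
      unfolding evv em_companion using mon d uL by (intro pact_companion) auto
    then show ?thesis using ev_in_vecs[OF v] by (simp add: pact_mult mult.assoc mult.left_commute)
  qed
  have "{coeff (g * (P * mp u) mod mp \<Theta>) | P. True} = {coeff (g * P mod mp \<Theta>) | P. True}"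
  proof (intro equalityI subsetI)
    fix c assume "c \<in> {coeff (g * P mod mp \<Theta>) | P. True}"
    then obtain P where c: "c = coeff (g * P mod mp \<Theta>)" by blast
    \<comment> \<open>The multiplier \<open>P * mp w\<close> in place of \<open>P\<close> cancels
      \<open>mp u\<close>.\<close>
    have "g * (P * mp w * mp u) mod mp \<Theta> = g * P * (mp w * mp u mod mp \<Theta>) mod mp \<Theta>"
      by (simp only: mod_mult_right_eq mult.assoc[symmetric])
    then have "c = coeff (g * (P * mp w * mp u) mod mp \<Theta>)"
      using c wu by simp
    then show "c \<in> {coeff (g * (P * mp u) mod mp \<Theta>) | P. True}" by blast
  qed auto
  then show ?thesis
    using act unfolding poly_code_def cyc_code_def Let_def v_def[symmetric] pact_def[symmetric] by simp
qed

end

subsection \<open>Generalized rank weights\<close>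

lemma gen_rank_weight_le:
  assumes "vsc.subspace D" "D \<subseteq> C" "vsc.dim D = r"
  shows "gen_rank_weight emb C r \<le> wtR emb D"
  using assms by (auto simp: gen_rank_weight_def intro!: wellorder_Inf_le1)

text \<open>The given \<open>D\<close> makes the set under \<open>Inf\<close> nonempty. For
  \<open>r = 0\<close> the weight is 0 by definition and \<open>{0}\<close> attains it.\<close>

lemma gen_rank_weight_attained:
  assumes "vsc.subspace D" "D \<subseteq> C" "vsc.dim D = r"
  obtains D' where "vsc.subspace D'" "D' \<subseteq> C" "vsc.dim D' = r" "wtR emb D' = gen_rank_weight emb C r"
proof (cases "r = 0")
  case True
  have "0 \<in> C" using assms(1,2) vsc.subspace_0 by blast
  then show ?thesis using that[of "{0}"] True by (simp add: gen_rank_weight_def)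
next
  case False
  let ?S = "{wtR emb D | D. vsc.subspace D \<and> D \<subseteq> C \<and> vsc.dim D = r}"
  have "?S \<noteq> {}" using assms by blast
  then have "Inf ?S \<in> ?S" by (rule Inf_nat_def1)
  then show ?thesis using that False by (auto simp: gen_rank_weight_def)
qed

context field_emb
begin

text \<open>Supplies the lower bound. Each step maps \<open>D\<close> by one \<open>B j\<close>,
  takes the dimension of the image as \<open>rr j\<close> and continues with the kernel, which is
  why \<open>D\<close> varies in the induction. The existence of the subspaces \<open>D'\<close> is
  recorded because it later bounds \<open>rr i\<close>.\<close>

lemma exists_rank_distribution:
  assumes "finite I" "vsc.subspace D" "D \<subseteq> vecs n"
    and "\<And>i. i \<in> I \<Longrightarrow> mat_act n (em (B i)) ` D \<subseteq> C i"
    and "\<And>c. c \<in> D \<Longrightarrow> (\<And>i. i \<in> I \<Longrightarrow> mat_act n (em (B i)) c = 0) \<Longrightarrow> c = 0"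
  shows "\<exists>rr. (\<forall>i\<in>I. \<exists>D'. vsc.subspace D' \<and> D' \<subseteq> C i \<and> vsc.dim D' = rr i)
    \<and> (\<Sum>i\<in>I. rr i) = vsc.dim D \<and> (\<Sum>i\<in>I. gen_rank_weight emb (C i) (rr i)) \<le> wtR emb D"
proof -
  \<comment> \<open>The abbreviation keeps \<open>vsc\<close> from being eta-expanded, and then unfolded by the simplifier, in the induction.\<close>
  define P where "P I D \<longleftrightarrow> (\<exists>rr. (\<forall>i\<in>I. \<exists>D'. vsc.subspace D' \<and> D' \<subseteq> C i \<and> vsc.dim D' = rr i)
    \<and> (\<Sum>i\<in>I. rr i) = vsc.dim D \<and> (\<Sum>i\<in>I. gen_rank_weight emb (C i) (rr i)) \<le> wtR emb D)" for I D
  have "P I D" using assms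
  proof (induction I arbitrary: D rule: finite_induct)
    case empty
    \<comment> \<open>When no map is left, joint injectivity forces \<open>D\<close> to be
      zero.\<close>
    have "D = {0}" using empty.prems(1,4) vsc.subspace_0 by blast
    then have "P {} D" by (simp add: P_def)
    then show ?case .
  next
    case (insert j I)
    have S: "vsc.subspace D" by (rule insert.prems(1))
    let ?B = "mat_act n (em (B j))"
    interpret Bj: Vector_Spaces.linear vsc vsc ?B by (rule lin_mat_act)
    let ?D0 = "{c\<in>D. ?B c = 0}"
    have "vsc.subspace ?D0"
      using S by (auto simp: vsc.subspace_def Bj.zero Bj.add Bj.scale)
    moreover have "?D0 \<subseteq> vecs n" using insert.prems(2) by blast
    moreover have "mat_act n (em (B i)) ` ?D0 \<subseteq> C i" if "i \<in> I" for i
      using insert.prems(3)[of i] that by blast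
    moreover have "c = 0" if "c \<in> ?D0" "\<And>i. i \<in> I \<Longrightarrow> mat_act n (em (B i)) c = 0" for c
      using insert.prems(4)[of c] that by blast
    ultimately obtain rr where rr: "\<forall>i\<in>I. \<exists>D'. vsc.subspace D' \<and> D' \<subseteq> C i \<and> vsc.dim D' = rr i"
        "(\<Sum>i\<in>I. rr i) = vsc.dim ?D0" "(\<Sum>i\<in>I. gen_rank_weight emb (C i) (rr i)) \<le> wtR emb ?D0"
      using insert.IH[of ?D0] unfolding P_def by blast
    have sub: "vsc.subspace (?B ` D)" using S by (rule Bj.subspace_image)
    have im: "?B ` D \<subseteq> C j" using insert.prems(3) by simp
    let ?rr = "rr(j := vsc.dim (?B ` D))"
    have eq: "(\<Sum>i\<in>I. gen_rank_weight emb (C i) (?rr i)) = (\<Sum>i\<in>I. gen_rank_weight emb (C i) (rr i))"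
        "(\<Sum>i\<in>I. ?rr i) = (\<Sum>i\<in>I. rr i)"
      using insert.hyps by (auto intro!: sum.cong)
    have "\<forall>i\<in>insert j I. \<exists>D'. vsc.subspace D' \<and> D' \<subseteq> C i \<and> vsc.dim D' = ?rr i"
      using rr(1) sub im by auto
    moreover have "(\<Sum>i\<in>insert j I. ?rr i) = vsc.dim D"
      using insert.hyps rr(2) rank_nullity_vecs[OF lin_mat_act[of n "em (B j)"] S insert.prems(2)] eq(2) by simp
    moreover have "(\<Sum>i\<in>insert j I. gen_rank_weight emb (C i) (?rr i)) \<le> wtR emb D"
      using insert.hyps eq(1) rr(3) gen_rank_weight_le[OF sub im refl, of emb]
        wtR_kernel_image[OF insert.prems(2), of emb n "B j"] by simp
    ultimately have "P (insert j I) D" unfolding P_def by blast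
    then show ?case .
  qed
  then show ?thesis by (simp only: P_def)
qed

text \<open>Supplies the upper bound. \<open>D'\<close> is the sum of the images of the
  \<open>D i\<close> under the \<open>A i\<close>; the maps \<open>B i\<close> separate the
  summands, which makes the sum direct.\<close>

lemma exists_sum_subcode:
  assumes "finite I" and C: "vsc.subspace C" "C \<subseteq> vecs n"
    and D: "\<And>i. i \<in> I \<Longrightarrow> vsc.subspace (D i)" "\<And>i. i \<in> I \<Longrightarrow> D i \<subseteq> vecs (d i)"
    and AC: "\<And>i. i \<in> I \<Longrightarrow> mat_act (d i) (em (A i)) ` D i \<subseteq> C"
    and BA_eq_0: "\<And>i j c. i \<in> I \<Longrightarrow> j \<in> I \<Longrightarrow> i \<noteq> j \<Longrightarrow> c \<in> D j \<Longrightarrow>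
           mat_act n (em (B i)) (mat_act (d j) (em (A j)) c) = 0"
    and BA_inj: "\<And>i c. i \<in> I \<Longrightarrow> c \<in> D i \<Longrightarrow>
           mat_act n (em (B i)) (mat_act (d i) (em (A i)) c) = 0 \<Longrightarrow> c = 0"
  shows "\<exists>D'. vsc.subspace D' \<and> D' \<subseteq> C \<and> vsc.dim D' = (\<Sum>i\<in>I. vsc.dim (D i))
    \<and> wtR emb D' \<le> (\<Sum>i\<in>I. wtR emb (D i))"
proof -
  \<comment> \<open>The last conjunct is an added invariant: the partial sum over \<open>J\<close>
    is killed by \<open>B j\<close> for each \<open>j\<close> in \<open>I\<close> outside
    \<open>J\<close>. It makes the kernel of \<open>B j\<close> on the next sum exactly the previous
    sum.\<close>
  define P where "P J \<longleftrightarrow> (\<exists>D'. vsc.subspace D' \<and> D' \<subseteq> C \<and> vsc.dim D' = (\<Sum>i\<in>J. vsc.dim (D i))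
    \<and> wtR emb D' \<le> (\<Sum>i\<in>J. wtR emb (D i)) \<and> (\<forall>c\<in>D'. \<forall>j\<in>I - J. mat_act n (em (B j)) c = 0))" for J
  have "P J" if "finite J" "J \<subseteq> I" for J using that
  proof (induction J rule: finite_induct)
    case empty
    have "\<forall>c\<in>{0}. \<forall>j\<in>I - {}. mat_act n (em (B j)) c = 0"
      using vsc.linear_0[OF lin_mat_act] by blast
    moreover have "vsc.dim {0::nat \<Rightarrow> 'l} = (\<Sum>i\<in>{}. vsc.dim (D i))"
      "wtR emb {0} \<le> (\<Sum>i\<in>{}. wtR emb (D i))" by simp_all
    moreover have "{0} \<subseteq> C" using vsc.subspace_0[OF C(1)] by simp
    ultimately have "P {}" unfolding P_def using vsc.subspace_single_0 by blast
    then show ?case .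
  next
    case (insert j J)
    have j: "j \<in> I" "j \<notin> J" using insert.prems insert.hyps by auto
    have "P J" using insert.IH insert.prems by simp
    then obtain E where E: "vsc.subspace E" "E \<subseteq> C" "vsc.dim E = (\<Sum>i\<in>J. vsc.dim (D i))"
       "wtR emb E \<le> (\<Sum>i\<in>J. wtR emb (D i))"
       and BE: "\<And>c i. c \<in> E \<Longrightarrow> i \<in> I \<Longrightarrow> i \<notin> J \<Longrightarrow> mat_act n (em (B i)) c = 0" unfolding P_def by auto
    let ?A = "mat_act (d j) (em (A j))" and ?B = "\<lambda>j. mat_act n (em (B j))"
    interpret A: Vector_Spaces.linear vsc vsc ?A by (rule lin_mat_act)
    interpret B: Vector_Spaces.linear vsc vsc "?B i" for i by (rule lin_mat_act)
    let ?AD = "?A ` D j"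
    let ?D = "{c + c' | c c'. c \<in> E \<and> c' \<in> ?AD}"
    have Dj: "vsc.subspace (D j)" "D j \<subseteq> vecs (d j)" using D j(1) by blast+
    have AD: "vsc.subspace ?AD" "?AD \<subseteq> C"
      using A.subspace_image[OF Dj(1)] AC[OF j(1)] by auto
    have sub: "vsc.subspace ?D" using E(1) AD(1) by (rule vsc.subspace_sums)
    have DC: "?D \<subseteq> C" using E(2) AD(2) vsc.subspace_add[OF C(1)] by blast
    have ker: "{c\<in>?D. ?B j c = 0} = E"
    proof (intro equalityI subsetI)
      fix x assume x: "x \<in> {c\<in>?D. ?B j c = 0}"
      then obtain c y where cy: "x = c + ?A y" "c \<in> E" "y \<in> D j" by blast
      have "?B j (?A y) = 0" using x cy BE[OF cy(2) j] by (simp add: B.add)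
      then have "y = 0" using BA_inj[OF j(1)] cy(3) by blast
      then show "x \<in> E" using cy by (simp add: A.zero)
    next
      fix x assume x: "x \<in> E"
      have "0 \<in> ?AD" using vsc.subspace_0[OF AD(1)] .
      moreover have "x = x + 0" by simp
      ultimately have "x \<in> ?D" using x by blast
      then show "x \<in> {c\<in>?D. ?B j c = 0}" using BE[OF x j] by blast
    qed
    have im: "?B j ` ?D = (?B j \<circ> ?A) ` D j"
    proof (intro equalityI subsetI)
      fix x assume "x \<in> ?B j ` ?D"
      then obtain c y where cy: "x = ?B j (c + ?A y)" "c \<in> E" "y \<in> D j" by blast
      then show "x \<in> (?B j \<circ> ?A) ` D j" using BE[OF cy(2) j] by (simp add: B.add)
    next
      fix x assume "x \<in> (?B j \<circ> ?A) ` D j"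
      then obtain y where y: "x = ?B j (0 + ?A y)" "y \<in> D j" by auto
      moreover have "0 \<in> E" using vsc.subspace_0[OF E(1)] .
      ultimately show "x \<in> ?B j ` ?D" by blast
    qed
    have "vsc.dim ((?B j \<circ> ?A) ` D j) = vsc.dim (D j)"
    proof (rule dim_inj_image_vecs[OF _ Dj])
      show "lin (?B j \<circ> ?A)"
        by (simp add: lin_iff A.add B.add A.scale B.scale)
      show "x = 0" if "x \<in> D j" "(?B j \<circ> ?A) x = 0" for x
        using BA_inj[OF j(1)] that by simp
    qed
    \<comment> \<open>Rank-nullity for \<open>B j\<close>: its kernel on \<open>?D\<close> is
      \<open>E\<close>, and its image has the dimension of \<open>D j\<close>.\<close>
    then have "vsc.dim ?D = vsc.dim E + vsc.dim (D j)"
      using rank_nullity_vecs[OF lin_mat_act[of n "em (B j)"] sub, of n] DC C(2) ker im by auto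
    moreover have "wtR emb ?D \<le> wtR emb E + wtR emb (D j)"
      using wtR_add_le[of E n ?AD emb] E(2) AD(2) C(2) wtR_image_le[OF Dj(2), of emb "d j" "A j"] by force
    moreover have "\<forall>c\<in>?D. \<forall>i\<in>I - insert j J. ?B i c = 0"
    proof (intro ballI)
      fix x i assume x: "x \<in> ?D" and i: "i \<in> I - insert j J"
      then obtain c y where cy: "x = c + ?A y" "c \<in> E" "y \<in> D j" by blast
      then show "?B i x = 0" using BE[OF cy(2), of i] BA_eq_0[of i j y] i j by (simp add: B.add)
    qed
    moreover have "vsc.dim ?D = (\<Sum>i\<in>insert j J. vsc.dim (D i))"
      using calculation(1) E(3) insert.hyps by simp
    moreover have "wtR emb ?D \<le> (\<Sum>i\<in>insert j J. wtR emb (D i))"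
      using calculation(2) E(4) insert.hyps by simp
    ultimately have "P (insert j J)" unfolding P_def
      using sub DC by blast
    then show ?case .
  qed
  from this[OF \<open>finite I\<close> order_refl] show ?thesis unfolding P_def by blast
qed

end

subsection \<open>Polynomial codes\<close>

lemma dim_vecs: "vsc.dim (vecs r :: (nat \<Rightarrow> 'a::field) set) = r"
proof -
  let ?U = "unitv ` {..<r} :: (nat \<Rightarrow> 'a) set"
  have inj: "inj_on (unitv :: nat \<Rightarrow> nat \<Rightarrow> 'a) {..<r}"
    by (auto simp: inj_on_def unitv_def fun_eq_iff)
  have "vsc.independent ?U"
  proof (rule vsc.independent_if_scalars_zero)
    fix u :: "(nat \<Rightarrow> 'a) \<Rightarrow> 'a" and x assume *: "(\<Sum>x\<in>?U. vsc (u x) x) = 0" "x \<in> ?U"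
    then obtain i where i: "i < r" "x = unitv i" by auto
    have "0 = (\<Sum>x\<in>?U. vsc (u x) x) i" using * by simp
    also have "\<dots> = (\<Sum>j<r. vsc (u (unitv j)) (unitv j)) i"
      by (simp add: sum.reindex[OF inj])
    also have "\<dots> = u (unitv i)"
      using i by (simp add: sum_fun_apply unitv_def if_distrib sum.delta cong: if_cong)
    finally show "u x = 0" using i by simp
  qed simp
  then have "card ?U = vsc.dim (vecs r :: (nat \<Rightarrow> 'a) set)"
    using vecs_subset_span by (intro vsc.basis_card_eq_dim) auto
  then show ?thesis using card_image[OF inj] by simp
qed

lemma lin_coeff_mult: "lin (\<lambda>c. coeff (g * polyv r c))"
proof -
  have "polyv r (c + c') = polyv r c + polyv r c'" "polyv r (vsc a c) = smult a (polyv r c)" for c c' :: "nat \<Rightarrow> 'a" and a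
    by (auto simp: poly_eq_iff coeff_polyv)
  then show ?thesis by (simp add: lin_iff distrib_left coeff_add_fun coeff_smult_fun)
qed

lemma dim_multiples:
  assumes "g \<noteq> (0 :: 'a::field poly)"
  shows "vsc.dim ((\<lambda>c. coeff (g * polyv r c)) ` vecs r) = r"
proof -
  have "c = 0" if "c \<in> vecs r" "coeff (g * polyv r c) = 0" for c
    using that assms coeff_polyv_vecs[OF that(1)] by (simp add: coeff_eq_0_fun_iff)
  then show ?thesis
    using dim_inj_image_vecs[OF lin_coeff_mult subspace_vecs order_refl, of r g r] dim_vecs by metis
qed

lemma coeff_mult_polyv_in_vecs: "coeff (g * polyv r c) \<in> vecs (degree g + r)"
proof -
  have "coeff (polyv r c) \<in> vecs r" by (simp add: vecs_def coeff_polyv)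
  then show ?thesis unfolding coeff_in_vecs_iff
    by (metis add_less_cancel_left degree_mult_le le_less_trans mult_zero_right nat_add_left_cancel_less)
qed

text \<open>With \<open>mp \<Theta> = g * q\<close>, reducing a multiple of \<open>g\<close> modulo
  \<open>mp \<Theta>\<close> reduces its cofactor modulo \<open>q\<close>. The code therefore
  consists of \<open>g\<close> times the polynomials of degree below \<open>degree q\<close>, and
  bounding the degree of the cofactor further by \<open>r\<close> gives the subcodes.\<close>

lemma (in field_emb)
  assumes mon: "lead_coeff \<Theta> = 1" and d: "0 < degree \<Theta>" and g: "g dvd mp \<Theta>"
  shows poly_code_subset_vecs: "poly_code emb \<Theta> g \<subseteq> vecs (degree \<Theta>)"
    and dim_subcode_poly_code_le: "\<And>D. vsc.subspace D \<Longrightarrow> D \<subseteq> poly_code emb \<Theta> g \<Longrightarrow> vsc.dim D \<le> degree \<Theta> - degree g"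
    and exists_subcode_poly_code: "\<And>r. r \<le> degree \<Theta> - degree g \<Longrightarrow>
      \<exists>D. vsc.subspace D \<and> D \<subseteq> poly_code emb \<Theta> g \<and> vsc.dim D = r \<and> wtR emb D \<le> degree g + r"
proof -
  let ?k = "degree \<Theta> - degree g"
  note code = poly_code_eq[OF mon d]
  have T0: "mp \<Theta> \<noteq> 0" using mon by auto
  obtain q where q: "mp \<Theta> = g * q" using g by (auto elim: dvdE)
  then have g0: "g \<noteq> 0" "q \<noteq> 0" using T0 by auto
  have deg: "degree \<Theta> = degree g + degree q"
    using q g0 by (metis degree_mp degree_mult_eq)
  have red: "g * P mod mp \<Theta> = g * (P mod q)" for P
    unfolding q by (simp only: mult_mod_right)
  have img: "poly_code emb \<Theta> g = (\<lambda>c. coeff (g * polyv ?k c)) ` vecs ?k"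
  proof (intro equalityI subsetI)
    fix x assume "x \<in> poly_code emb \<Theta> g"
    then obtain P where P: "x = coeff (g * (P mod q))" unfolding code red by blast
    have "coeff (P mod q) \<in> vecs ?k" using coeff_mod_in_vecs[OF g0(2)] deg by simp
    then show "x \<in> (\<lambda>c. coeff (g * polyv ?k c)) ` vecs ?k"
      unfolding P by (metis imageI polyv_coeff)
  next
    fix x assume "x \<in> (\<lambda>c. coeff (g * polyv ?k c)) ` vecs ?k"
    then obtain c where c: "x = coeff (g * polyv ?k c)" by blast
    have "polyv ?k c mod q = polyv ?k c"
      by (rule poly_mod_unique) (auto simp: vecs_def coeff_polyv deg)
    then have "x = coeff (g * polyv ?k c mod mp \<Theta>)" using c red by simp
    then show "x \<in> poly_code emb \<Theta> g" unfolding code by blast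
  qed
  interpret L: Vector_Spaces.linear vsc vsc "\<lambda>c. coeff (g * polyv r c)" for r by (rule lin_coeff_mult)
  show sub: "poly_code emb \<Theta> g \<subseteq> vecs (degree \<Theta>)"
    unfolding code using coeff_mod_in_vecs[OF T0] by auto
  show "vsc.dim D \<le> ?k" if "vsc.subspace D" "D \<subseteq> poly_code emb \<Theta> g" for D
    using dim_vecs_mono[OF that(2) sub] dim_multiples[OF g0(1), of ?k] unfolding img by simp
  show "\<exists>D. vsc.subspace D \<and> D \<subseteq> poly_code emb \<Theta> g \<and> vsc.dim D = r \<and> wtR emb D \<le> degree g + r"
    if r: "r \<le> ?k" for r
  proof (intro exI conjI)
    let ?D = "(\<lambda>c. coeff (g * polyv r c)) ` vecs r"
    show "vsc.subspace ?D" by (rule L.subspace_image) simp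
    show "vsc.dim ?D = r" by (rule dim_multiples[OF g0(1)])
    show "wtR emb ?D \<le> degree g + r"
      by (rule wtR_le) (use coeff_mult_polyv_in_vecs in blast)
    have "polyv r c mod q = polyv r c" for c
      using r deg by (intro poly_mod_unique) (auto simp: vecs_def coeff_polyv)
    then have "coeff (g * polyv r c) = coeff (g * polyv r c mod mp \<Theta>)" for c by (simp add: red)
    then show "?D \<subseteq> poly_code emb \<Theta> g" unfolding code by blast
  qed
qed

subsection \<open>Splitting a cyclic code\<close>

text \<open>The data behind the identification of L^n with L[x] modulo \<open>mp f\<close>, with
  \<open>v\<close> kept over K. \<open>f_deg\<close> and \<open>f_act\<close> are the consequences
  of minimality drawn in \<open>min_poly_cyclic\<close>.\<close>

locale cyclic_ext = field_emb emb for emb :: "'k::field \<Rightarrow> 'l::field" +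
  fixes n :: nat and M :: "nat \<Rightarrow> nat \<Rightarrow> 'k" and v :: "nat \<Rightarrow> 'k" and f :: "'k poly"
  assumes cyc: "cyclic_vec n M v" and f_monic: "lead_coeff f = 1"
    and f_deg: "degree f = n" and f_act: "pact n M f v = 0"
begin

lemma v_in_vecs: "v \<in> vecs n"
  using cyc by (simp add: cyclic_vec_iff)

lemma evv_in_vecs: "ev v \<in> vecs n"
  using v_in_vecs by (rule ev_in_vecs)

definition \<Phi> :: "'l poly \<Rightarrow> nat \<Rightarrow> 'l" where
  "\<Phi> P = pact n (em M) P (ev v)"

text \<open>Preimages of the unit vectors, taken over K so that maps expressed through them get
  matrices over K.\<close>

definition dual :: "nat \<Rightarrow> 'k poly" where
  "dual j = (SOME P. coeff P \<in> vecs n \<and> pact n M P v = unitv j)"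

text \<open>The inverse of \<Phi> on polynomials of degree below \<open>n\<close>.\<close>

definition \<Psi> :: "(nat \<Rightarrow> 'l) \<Rightarrow> 'l poly" where
  "\<Psi> c = (\<Sum>j<n. smult (c j) (mp (dual j)))"

lemma dual: "j < n \<Longrightarrow> coeff (dual j) \<in> vecs n" "j < n \<Longrightarrow> pact n M (dual j) v = unitv j"
proof -
  assume "j < n"
  then have "\<exists>P. coeff P \<in> vecs n \<and> pact n M P v = unitv j"
    using cyc unfolding cyclic_vec_iff by (metis unitv_in_vecs)
  then have "coeff (dual j) \<in> vecs n \<and> pact n M (dual j) v = unitv j"
    unfolding dual_def by (rule someI_ex)
  then show "coeff (dual j) \<in> vecs n" "pact n M (dual j) v = unitv j" by auto
qed

lemma \<Phi>_in_vecs [simp]: "\<Phi> P \<in> vecs n"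
  by (simp add: \<Phi>_def)

lemma \<Phi>_add: "\<Phi> (P + Q) = \<Phi> P + \<Phi> Q"
  by (simp add: \<Phi>_def pact_add evv_in_vecs)

lemma \<Phi>_diff: "\<Phi> (P - Q) = \<Phi> P - \<Phi> Q"
  by (simp add: \<Phi>_def pact_diff evv_in_vecs)

lemma \<Phi>_smult: "\<Phi> (smult a P) = vsc a (\<Phi> P)"
  by (simp add: \<Phi>_def pact_smult evv_in_vecs)

lemma \<Phi>_sum: "\<Phi> (\<Sum>i\<in>I. P i) = (\<Sum>i\<in>I. \<Phi> (P i))"
  by (simp add: \<Phi>_def pact_sum evv_in_vecs)

lemma \<Phi>_mp: "\<Phi> (mp P) = ev (pact n M P v)"
  by (simp add: \<Phi>_def pact_ev v_in_vecs)

lemma \<Phi>_\<Psi>: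
  assumes "c \<in> vecs n"
  shows "\<Phi> (\<Psi> c) = c"
proof -
  have "ev (unitv j) = unitv j" for j by (auto simp: unitv_def)
  then have "\<Phi> (\<Psi> c) = (\<Sum>j<n. vsc (c j) (unitv j))"
    by (simp add: \<Psi>_def \<Phi>_sum \<Phi>_smult \<Phi>_mp dual)
  then show ?thesis using vecs_decompose[OF assms] by simp
qed

text \<open>Both sides have degree below \<open>n\<close> and send \<open>v\<close> to the same
  vector, so cyclicity over K identifies them.\<close>

lemma dual_expansion:
  assumes "coeff P \<in> vecs n"
  shows "(\<Sum>j<n. smult (pact n M P v j) (dual j)) = P"
proof -
  let ?Q = "\<Sum>j<n. smult (pact n M P v j) (dual j)"
  have "pact n M ?Q v = (\<Sum>j<n. vsc (pact n M P v j) (unitv j))"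
    by (simp add: pact_sum pact_smult v_in_vecs dual)
  also have "\<dots> = pact n M P v" using vecs_decompose[of "pact n M P v" n] by simp
  finally have "pact n M (?Q - P) v = 0" by (simp add: pact_diff v_in_vecs)
  moreover have "coeff (?Q - P) \<in> vecs n"
    using dual(1) assms by (auto simp: vecs_def coeff_sum)
  ultimately have "?Q - P = 0" using cyclic_vec_inj[OF cyc] by blast
  then show ?thesis by simp
qed

text \<open>By linearity over L it suffices to treat monomials; these come from K[x], where
  \<open>dual_expansion\<close> applies. Thus cyclicity over K already gives uniqueness over
  L.\<close>

lemma \<Psi>_\<Phi>:
  assumes "coeff P \<in> vecs n"
  shows "\<Psi> (\<Phi> P) = P"
proof -
  have P: "P = (\<Sum>i<n. smult (coeff P i) (mp (monom 1 i)))"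
    using polyv_coeff[OF assms] by (simp add: polyv_def mp_monom smult_monom)
  have m: "\<Psi> (\<Phi> (mp (monom 1 i))) = mp (monom 1 i)" if "i < n" for i
  proof -
    have "coeff (monom (1::'k) i) \<in> vecs n" using that by (auto simp: vecs_def)
    from dual_expansion[OF this] show ?thesis
      by (simp add: \<Psi>_def \<Phi>_mp flip: mp_smult mp_sum)
  qed
  have "\<Psi> (\<Phi> P) = (\<Sum>j<n. \<Sum>i<n. smult (coeff P i * \<Phi> (mp (monom 1 i)) j) (mp (dual j)))"
    by (subst P) (simp add: \<Psi>_def \<Phi>_sum \<Phi>_smult sum_fun_apply smult_sum)
  also have "\<dots> = (\<Sum>i<n. smult (coeff P i) (\<Psi> (\<Phi> (mp (monom 1 i)))))"
    by (subst sum.swap) (simp add: \<Psi>_def smult_sum_right)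
  also have "\<dots> = P" by (subst (2) P) (simp add: m)
  finally show ?thesis .
qed

lemma mp_f_ne_0: "mp f \<noteq> 0"
  using f_monic by auto

lemma \<Phi>_multiple [simp]: "\<Phi> (P * mp f) = 0"
proof -
  have "\<Phi> (mp f) = 0" by (simp add: \<Phi>_mp f_act fun_eq_iff)
  then show ?thesis
    using vsc.linear_0[OF lin_pact[of n "em M" P]] by (simp add: \<Phi>_def pact_mult evv_in_vecs)
qed

text \<open>The remainder modulo \<open>mp f\<close> has degree below \<open>n\<close>, so \<Psi>
  recovers it from its image 0.\<close>

lemma \<Phi>_eq_0_iff: "\<Phi> P = 0 \<longleftrightarrow> mp f dvd P"
proof
  assume *: "\<Phi> P = 0"
  have "P mod mp f = P - P div mp f * mp f" by (simp add: minus_div_mult_eq_mod)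
  then have "\<Phi> (P mod mp f) = 0" by (simp only: \<Phi>_diff \<Phi>_multiple * diff_zero)
  moreover have "coeff (P mod mp f) \<in> vecs n"
    using coeff_mod_in_vecs[OF mp_f_ne_0, of P] f_deg by simp
  ultimately have "P mod mp f = 0" using \<Psi>_\<Phi>[of "P mod mp f"] by (simp add: \<Psi>_def)
  then show "mp f dvd P" by auto
next
  assume "mp f dvd P"
  then show "\<Phi> P = 0" by (auto elim!: dvdE simp: mult.commute[of "mp f"])
qed

lemma \<Phi>_eq_iff: "\<Phi> P = \<Phi> Q \<longleftrightarrow> mp f dvd P - Q"
  by (simp flip: \<Phi>_eq_0_iff add: \<Phi>_diff)

text \<open>\<open>Bmat F\<close> is the matrix of the reduction \<open>\<Phi> P \<mapsto> P mod F\<close>, and \<open>Amat h\<close> that of the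
multiplication \<open>Q \<mapsto> \<Phi> (h * Q)\<close>. Both have entries in K, which is what makes them compatible
with rank supports.\<close>

definition Bmat :: "'k poly \<Rightarrow> nat \<Rightarrow> nat \<Rightarrow> 'k" where
  "Bmat F = (\<lambda>t j. coeff (dual j mod F) t)"

definition Amat :: "'k poly \<Rightarrow> nat \<Rightarrow> nat \<Rightarrow> 'k" where
  "Amat h = (\<lambda>t j. pact n M (h * monom 1 j) v t)"

text \<open>\<open>\<Psi> (\<Phi> P)\<close> and \<open>P\<close> differ by a multiple of
  \<open>mp f\<close>, which is invisible modulo its divisor \<open>mp F\<close>. Reducing
  \<open>\<Psi> c\<close> amounts to reducing the polynomials \<open>dual j\<close>, whose
  coefficients lie in K.\<close>

lemma Bmat_\<Phi>:
  assumes "F dvd f" "F \<noteq> 0"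
  shows "mat_act n (em (Bmat F)) (\<Phi> P) = coeff (P mod mp F)"
proof -
  have "mp F dvd mp f" using assms(1) by (auto elim!: dvdE simp: mp_mult)
  moreover have "mp f dvd \<Psi> (\<Phi> P) - P" using \<Phi>_\<Psi>[of "\<Phi> P"] by (simp flip: \<Phi>_eq_iff)
  ultimately have "\<Psi> (\<Phi> P) mod mp F = P mod mp F"
    by (metis dvd_trans mod_eq_dvd_iff)
  moreover have "mat_act n (em (Bmat F)) c = coeff (\<Psi> c mod mp F)" for c
  proof -
    have "\<Psi> c mod mp F = (\<Sum>j<n. smult (c j) (mp (dual j mod F)))"
      unfolding \<Psi>_def by (simp add: mp_mod[OF assms(2)] poly_mod_sum mod_smult_left)
    then show ?thesis by (simp add: fun_eq_iff mat_act_def Bmat_def coeff_sum mult.commute)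
  qed
  ultimately show ?thesis by simp
qed

lemma Amat_coeff:
  assumes "coeff P \<in> vecs d"
  shows "mat_act d (em (Amat h)) (coeff P) = \<Phi> (mp h * P)"
proof -
  have "mp h * P = (\<Sum>j<d. smult (coeff P j) (mp (h * monom 1 j)))"
  proof -
    have P: "P = (\<Sum>j<d. smult (coeff P j) (mp (monom 1 j)))"
      using polyv_coeff[OF assms] by (simp add: polyv_def mp_monom smult_monom)
    show ?thesis by (subst P) (simp add: sum_distrib_left mp_mult)
  qed
  then have "\<Phi> (mp h * P) = (\<Sum>j<d. vsc (coeff P j) (ev (pact n M (h * monom 1 j) v)))"
    by (simp only: \<Phi>_sum \<Phi>_smult \<Phi>_mp)
  then show ?thesis by (simp add: fun_eq_iff mat_act_def Amat_def sum_fun_apply mult.commute)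
qed

end

subsection \<open>Distributions of the dimension\<close>

text \<open>Greedy choice: each new index takes as much of \<open>r\<close> as its capacity
  allows.\<close>

lemma exists_distribution:
  fixes kk :: "'i \<Rightarrow> nat"
  assumes "finite I" "r \<le> (\<Sum>i\<in>I. kk i)"
  shows "\<exists>rr. (\<forall>i\<in>I. rr i \<le> kk i) \<and> (\<Sum>i\<in>I. rr i) = r"
  using assms
proof (induction I arbitrary: r rule: finite_induct)
  case (insert j I)
  have "r - min r (kk j) \<le> (\<Sum>i\<in>I. kk i)" using insert.prems insert.hyps by auto
  then obtain rr where rr: "\<forall>i\<in>I. rr i \<le> kk i" "(\<Sum>i\<in>I. rr i) = r - min r (kk j)"
    using insert.IH by blast
  let ?rr = "rr(j := min r (kk j))"
  have "(\<Sum>i\<in>I. ?rr i) = (\<Sum>i\<in>I. rr i)" using insert.hyps by (auto intro!: sum.cong)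
  then have "(\<Sum>i\<in>insert j I. ?rr i) = r" using insert.hyps rr(2) by simp
  moreover have "\<forall>i\<in>insert j I. ?rr i \<le> kk i" using rr(1) by simp
  ultimately show ?case by blast
qed simp

text \<open>The numerical part of the theorem, to be used with \<open>G\<close> and
  \<open>W i\<close> as the weights of the cyclic code and of its components. For
  \<open>r = 1\<close> the distributions are the indicators of single indices; for
  \<open>r = k\<close> only \<open>kk\<close> itself remains.\<close>

lemma distribution_bounds:
  fixes W :: "'i \<Rightarrow> nat \<Rightarrow> nat" and G :: "nat \<Rightarrow> nat" and kk e d :: "'i \<Rightarrow> nat" and I :: "'i set"
  defines "R \<equiv> \<lambda>r. {rr. (\<forall>i\<in>I. rr i \<le> kk i) \<and> (\<Sum>i\<in>I. rr i) = r}"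
  assumes fin: "finite I" and k: "k = (\<Sum>i\<in>I. kk i)" "1 \<le> k"
    and kk1: "\<And>i. i \<in> I \<Longrightarrow> 1 \<le> kk i"
    and W0: "\<And>i. i \<in> I \<Longrightarrow> W i 0 = 0"
    and We: "\<And>i r. i \<in> I \<Longrightarrow> 1 \<le> r \<Longrightarrow> r \<le> kk i \<Longrightarrow> W i r \<le> e i + r"
    and d: "\<And>i. i \<in> I \<Longrightarrow> d i = e i + kk i"
    and upper: "\<And>r rr. 1 \<le> r \<Longrightarrow> r \<le> k \<Longrightarrow> rr \<in> R r \<Longrightarrow> G r \<le> (\<Sum>i\<in>I. W i (rr i))"
    and lower: "\<And>r. 1 \<le> r \<Longrightarrow> r \<le> k \<Longrightarrow> \<exists>rr\<in>R r. (\<Sum>i\<in>I. W i (rr i)) \<le> G r"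
  shows "1 \<le> r \<Longrightarrow> r \<le> k \<Longrightarrow> G r = Inf {\<Sum>i\<in>I. W i (rr i) | rr. (\<forall>i\<in>I. rr i \<le> kk i) \<and> (\<Sum>i\<in>I. rr i) = r}"
    and "1 \<le> r \<Longrightarrow> r \<le> k \<Longrightarrow> Inf {\<Sum>i\<in>I. W i (rr i) | rr. (\<forall>i\<in>I. rr i \<le> kk i) \<and> (\<Sum>i\<in>I. rr i) = r}
      \<le> Inf {(\<Sum>i\<in>{i\<in>I. rr i \<noteq> 0}. e i) + r | rr. (\<forall>i\<in>I. rr i \<le> kk i) \<and> (\<Sum>i\<in>I. rr i) = r}"
    and "G 1 = Min ((\<lambda>i. W i 1) ` I)"
    and "Min ((\<lambda>i. W i 1) ` I) \<le> Min ((\<lambda>i. e i + 1) ` I)"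
    and "G k = (\<Sum>i\<in>I. W i (kk i))"
    and "(\<Sum>i\<in>I. W i (kk i)) \<le> (\<Sum>i\<in>I. d i)"
proof -
  have ne: "I \<noteq> {}" using k by auto
  have S: "{X rr | rr. (\<forall>i\<in>I. rr i \<le> kk i) \<and> (\<Sum>i\<in>I. rr i) = r} = X ` R r" for r and X :: "('i \<Rightarrow> nat) \<Rightarrow> nat"
    by (auto simp: R_def)
  \<comment> \<open>\<open>lower\<close> gives a distribution whose sum is at most
    \<open>G r\<close> and \<open>upper\<close> the reverse inequality, so the infimum is a
    minimum.\<close>
  have min: "\<exists>rr\<in>R r. G r = (\<Sum>i\<in>I. W i (rr i))" if "1 \<le> r" "r \<le> k" for r
    using lower[OF that] upper[OF that] by (meson le_antisym)
  have GInf: "G r = Inf ((\<lambda>rr. \<Sum>i\<in>I. W i (rr i)) ` R r)" if r: "1 \<le> r" "r \<le> k" for r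
  proof -
    obtain rr where rr: "rr \<in> R r" "G r = (\<Sum>i\<in>I. W i (rr i))" using min[OF r] by blast
    show ?thesis
      by (rule cInf_eq_minimum[symmetric]) (use rr upper[OF r] in auto)
  qed
  show "1 \<le> r \<Longrightarrow> r \<le> k \<Longrightarrow> G r = Inf {\<Sum>i\<in>I. W i (rr i) | rr. (\<forall>i\<in>I. rr i \<le> kk i) \<and> (\<Sum>i\<in>I. rr i) = r}"
    unfolding S by (rule GInf)
  show "Inf {\<Sum>i\<in>I. W i (rr i) | rr. (\<forall>i\<in>I. rr i \<le> kk i) \<and> (\<Sum>i\<in>I. rr i) = r}
      \<le> Inf {(\<Sum>i\<in>{i\<in>I. rr i \<noteq> 0}. e i) + r | rr. (\<forall>i\<in>I. rr i \<le> kk i) \<and> (\<Sum>i\<in>I. rr i) = r}"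
    if r: "1 \<le> r" "r \<le> k"
    unfolding S
  proof (rule cInf_greatest)
    \<comment> \<open>A distribution exists by \<open>min\<close>; an infimum over the empty set
      would carry no information.\<close>
    show "(\<lambda>rr. (\<Sum>i\<in>{i\<in>I. rr i \<noteq> 0}. e i) + r) ` R r \<noteq> {}"
      using min[OF r] by blast
    fix x assume "x \<in> (\<lambda>rr. (\<Sum>i\<in>{i\<in>I. rr i \<noteq> 0}. e i) + r) ` R r"
    then obtain rr where rr: "rr \<in> R r" "x = (\<Sum>i\<in>{i\<in>I. rr i \<noteq> 0}. e i) + r" by blast
    have "Inf ((\<lambda>rr. \<Sum>i\<in>I. W i (rr i)) ` R r) \<le> (\<Sum>i\<in>I. W i (rr i))"
      using rr(1) by (intro wellorder_Inf_le1) blast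
    also have "\<dots> \<le> (\<Sum>i\<in>I. (if rr i \<noteq> 0 then e i else 0) + rr i)"
    proof (rule sum_mono)
      fix i assume i: "i \<in> I"
      then have "rr i \<le> kk i" using rr(1) by (simp add: R_def)
      then show "W i (rr i) \<le> (if rr i \<noteq> 0 then e i else 0) + rr i"
        using W0[OF i] We[OF i, of "rr i"] by auto
    qed
    also have "\<dots> = x"
      using rr fin by (simp add: sum.distrib R_def sum.inter_filter)
    finally show "Inf ((\<lambda>rr. \<Sum>i\<in>I. W i (rr i)) ` R r) \<le> x" .
  qed
  show "G 1 = Min ((\<lambda>i. W i 1) ` I)"
  proof (rule Min_eqI[symmetric])
    show "G 1 \<le> y" if "y \<in> (\<lambda>i. W i 1) ` I" for y
    proof -
      obtain i where i: "i \<in> I" "y = W i 1" using \<open>y \<in> _\<close> by blast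
      \<comment> \<open>All of the dimension 1 goes to \<open>i\<close>, which \<open>kk1\<close>
        permits.\<close>
      let ?rr = "\<lambda>j. if j = i then 1 else (0::nat)"
      have "?rr \<in> R 1" using i fin kk1 by (simp add: R_def sum.delta)
      then have "G 1 \<le> (\<Sum>j\<in>I. W j (?rr j))" using upper[of 1] k(2) by blast
      also have "\<dots> = (\<Sum>j\<in>I. if j = i then W j 1 else 0)" using W0 by (intro sum.cong) auto
      also have "\<dots> = y" using i fin by (simp add: sum.delta)
      finally show ?thesis .
    qed
    obtain rr where rr: "rr \<in> R 1" "G 1 = (\<Sum>i\<in>I. W i (rr i))" using min[of 1] k(2) by blast
    \<comment> \<open>Naturals with sum 1 consist of one entry 1 and zeros elsewhere.\<close>
    then obtain i where i: "i \<in> I" "rr i = 1" "\<And>j. j \<in> I \<Longrightarrow> j \<noteq> i \<Longrightarrow> rr j = 0"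
      using fin by (auto simp: R_def sum_eq_Suc0_iff)
    have "G 1 = (\<Sum>j\<in>I. if j = i then W j 1 else 0)"
      unfolding rr(2) using i W0 by (intro sum.cong) auto
    then have "G 1 = W i 1" using i fin by (simp add: sum.delta)
    then show "G 1 \<in> (\<lambda>i. W i 1) ` I" using i by blast
  qed (use fin in simp)
  show "Min ((\<lambda>i. W i 1) ` I) \<le> Min ((\<lambda>i. e i + 1) ` I)"
  proof (rule Min.boundedI)
    fix x assume "x \<in> (\<lambda>i. e i + 1) ` I"
    then obtain i where i: "i \<in> I" "x = e i + 1" by blast
    have "Min ((\<lambda>i. W i 1) ` I) \<le> W i 1" using i fin by simp
    then show "Min ((\<lambda>i. W i 1) ` I) \<le> x" using We[OF i(1), of 1] kk1[OF i(1)] i(2) by simp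
  qed (use fin ne in auto)
  show "G k = (\<Sum>i\<in>I. W i (kk i))"
  proof -
    obtain rr where rr: "rr \<in> R k" "G k = (\<Sum>i\<in>I. W i (rr i))" using min[of k] k(2) by blast
    \<comment> \<open>\<open>rr\<close> is bounded by \<open>kk\<close> and has the same sum, so no
      entry can be smaller.\<close>
    have "rr i = kk i" if "i \<in> I" for i
      using sum_mono_inv[of rr I kk i] rr(1) k(1) fin that by (simp add: R_def)
    then show ?thesis using rr(2) by simp
  qed
  show "(\<Sum>i\<in>I. W i (kk i)) \<le> (\<Sum>i\<in>I. d i)"
    using We kk1 d by (intro sum_mono) simp
qed

theorem theorem4:
  fixes emb :: "'k::field \<Rightarrow> 'l::field" and n k s :: nat
    and M :: "nat \<Rightarrow> nat \<Rightarrow> 'k" and f :: "'k poly"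
    and fs :: "nat \<Rightarrow> 'k poly" and ms :: "nat \<Rightarrow> nat"
    and g :: "'l poly" and gs :: "nat \<Rightarrow> 'l poly"
  assumes ext: "field_ext emb n"
    and cyc: "cyclic_mat n M" and minp: "is_min_poly n M f"
    and f_fact: "f = (\<Prod>i<s. fs i ^ ms i)"
    and fs_irr: "\<forall>i<s. lead_coeff (fs i) = 1 \<and> irreducible (fs i) \<and> 1 \<le> ms i"
    and fs_dist: "inj_on fs {..<s}"
    and g_monic: "lead_coeff g = 1" and g_dvd: "g dvd map_poly emb f"
    and k1: "1 \<le> k" and kn: "k \<le> n" and g_deg: "degree g = n - k"
    and g_prod: "g = (\<Prod>i<s. gs i)"
    and gs_dvd: "\<forall>i<s. lead_coeff (gs i) = 1 \<and> gs i dvd map_poly emb (fs i ^ ms i)"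
  defines "d \<equiv> (\<lambda>i. ms i * degree (fs i))"
    and "kk \<equiv> (\<lambda>i. ms i * degree (fs i) - degree (gs i))"
    and "\<Lambda> \<equiv> {i. i < s \<and> gs i \<noteq> map_poly emb (fs i ^ ms i)}"
    and "C \<equiv> (\<lambda>i. poly_code emb (fs i ^ ms i) (gs i))"
    and "Cg \<equiv> cyc_code emb n M g"
  shows "(\<forall>r\<in>{1..k}.
            gen_rank_weight emb Cg r =
              Inf {\<Sum>i\<in>\<Lambda>. gen_rank_weight emb (C i) (rr i) | rr.
                     (\<forall>i\<in>\<Lambda>. rr i \<le> kk i) \<and> (\<Sum>i\<in>\<Lambda>. rr i) = r}
          \<and> Inf {\<Sum>i\<in>\<Lambda>. gen_rank_weight emb (C i) (rr i) | rr.
                     (\<forall>i\<in>\<Lambda>. rr i \<le> kk i) \<and> (\<Sum>i\<in>\<Lambda>. rr i) = r}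
            \<le> Inf {(\<Sum>i\<in>{i\<in>\<Lambda>. rr i \<noteq> 0}. degree (gs i)) + r | rr.
                     (\<forall>i\<in>\<Lambda>. rr i \<le> kk i) \<and> (\<Sum>i\<in>\<Lambda>. rr i) = r})
      \<and> (\<forall>i\<in>\<Lambda>. \<forall>ri\<in>{1..kk i}. gen_rank_weight emb (C i) ri \<le> degree (gs i) + ri)
      \<and> gen_rank_weight emb Cg 1 = Min ((\<lambda>i. gen_rank_weight emb (C i) 1) ` \<Lambda>)
      \<and> Min ((\<lambda>i. gen_rank_weight emb (C i) 1) ` \<Lambda>) \<le> Min ((\<lambda>i. degree (gs i) + 1) ` \<Lambda>)
      \<and> gen_rank_weight emb Cg k = (\<Sum>i\<in>\<Lambda>. gen_rank_weight emb (C i) (kk i))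
      \<and> (\<Sum>i\<in>\<Lambda>. gen_rank_weight emb (C i) (kk i)) \<le> (\<Sum>i\<in>\<Lambda>. d i)"
proof -
  interpret field_emb emb
    using ext unfolding field_ext_def by unfold_locales auto
  \<comment> \<open>The very choice made in \<open>cyc_code\<close>, so that \<open>Cg\<close> can
    be expressed through \<Phi>.\<close>
  define v where "v = (SOME v. cyclic_vec n M v)"
  have cycv: "cyclic_vec n M v"
    using cyc unfolding v_def cyclic_mat_def by (rule someI_ex)
  interpret cyclic_ext emb n M v f
    using cycv min_poly_cyclic[OF cycv minp] minp by unfold_locales (auto simp: is_min_poly_def)

  \<comment> \<open>The factors of \<open>f\<close>, their cofactors and the component codes\<close>
  define F where "F = (\<lambda>i. fs i ^ ms i)"
  define h where "h = (\<lambda>i. \<Prod>j\<in>{..<s} - {i}. F j)"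
  have Fmon: "lead_coeff (F i) = 1" if "i < s" for i
    using fs_irr that by (simp add: F_def lead_coeff_power)
  have F0: "F i \<noteq> 0" if "i < s" for i
    using Fmon[OF that] by auto
  have Fdeg: "degree (F i) = d i" if "i < s" for i
  proof -
    have "fs i \<noteq> 0" using fs_irr that by auto
    then show ?thesis by (simp add: F_def d_def degree_power_eq)
  qed
  have Fdeg_pos: "0 < degree (F i)" if "i < s" for i
  proof -
    have "fs i \<noteq> 0" "\<not> is_unit (fs i)"
      using fs_irr that by (auto simp: irreducible_not_unit)
    then have "0 < degree (fs i)" by (auto simp: is_unit_iff_degree)
    then show ?thesis using fs_irr that by (auto simp: Fdeg[OF that] d_def Suc_le_eq)
  qed
  have comaxF: "comax (F i) (F j)" if "i < s" "j < s" "i \<noteq> j" for i j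
  proof -
    have "fs i \<noteq> fs j" using fs_dist that by (auto simp: inj_on_def)
    then have "comax (fs i) (fs j)" using fs_irr that by (intro monic_irreducible_comax) auto
    \<comment> \<open>\<open>comax_power\<close> raises the second argument only, hence the detour
      through symmetry.\<close>
    then have "comax (fs i ^ ms i) (fs j)" by (rule comax_sym[OF comax_power[OF comax_sym]])
    then show ?thesis unfolding F_def by (rule comax_power)
  qed
  have f_prod: "f = (\<Prod>i<s. F i)" using f_fact by (simp add: F_def)
  have fFh: "f = F i * h i" if "i < s" for i
    unfolding f_prod h_def using that by (simp add: prod.remove)
  have Fdvd: "F i dvd f" if "i < s" for i using fFh[OF that] by simp
  have gmon: "lead_coeff (gs i) = 1" and gdvd: "gs i dvd mp (F i)" if "i < s" for i
    using gs_dvd that by (auto simp: F_def)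
  have C_eq: "C i = {coeff (gs i * P mod mp (F i)) | P. True}" if "i < s" for i
    using poly_code_eq[OF Fmon[OF that] Fdeg_pos[OF that], of "gs i"] by (simp add: C_def F_def)
  have C_code: "C i = poly_code emb (F i) (gs i)" for i by (simp add: C_def F_def)
  have kk_eq: "kk i = degree (F i) - degree (gs i)" if "i < s" for i
    using Fdeg[OF that] by (simp add: kk_def d_def)
  have C_vecs: "C i \<subseteq> vecs (d i)" if "i < s" for i
    using poly_code_subset_vecs[OF Fmon Fdeg_pos gdvd, OF that that that] Fdeg[OF that] by (simp add: C_code)
  have C_dim: "vsc.dim D \<le> kk i" if "i < s" "vsc.subspace D" "D \<subseteq> C i" for i D
    using dim_subcode_poly_code_le[OF Fmon Fdeg_pos gdvd, OF that(1,1,1,2)] that by (simp add: C_code kk_eq)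
  have C_subcode: "\<exists>D. vsc.subspace D \<and> D \<subseteq> C i \<and> vsc.dim D = r \<and> wtR emb D \<le> degree (gs i) + r"
    if "i < s" "r \<le> kk i" for i r
    using exists_subcode_poly_code[OF Fmon Fdeg_pos gdvd, OF that(1,1,1)] that by (simp add: C_code kk_eq)
  have gsg: "gs i dvd g" if "i < s" for i
    unfolding g_prod using that by (intro dvd_prodI) auto
  have \<Lambda>: "finite \<Lambda>" "\<And>i. i \<in> \<Lambda> \<Longrightarrow> i < s" by (auto simp: \<Lambda>_def)

  \<comment> \<open>The code \<open>Cg\<close> as the image of the ideal generated by
    \<open>g\<close>\<close>
  have Cg_eq: "Cg = range (\<lambda>P. \<Phi> (g * P))"
    unfolding Cg_def cyc_code_def Let_def v_def[symmetric] pact_def[symmetric]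
    by (auto simp: \<Phi>_def mult.commute[of g] pact_mult evv_in_vecs)
  have Cg_vecs: "Cg \<subseteq> vecs n" unfolding Cg_eq by auto
  have Cg_sub: "vsc.subspace Cg"
  proof (rule vsc.subspaceI)
    have "\<Phi> (g * 0) = 0" by (simp add: \<Phi>_eq_0_iff)
    then show "0 \<in> Cg" unfolding Cg_eq by (metis rangeI)
    fix x y assume "x \<in> Cg" "y \<in> Cg"
    then obtain P Q where "x = \<Phi> (g * P)" "y = \<Phi> (g * Q)" unfolding Cg_eq by blast
    then have "x + y = \<Phi> (g * (P + Q))" by (simp add: distrib_left \<Phi>_add)
    then show "x + y \<in> Cg" unfolding Cg_eq by blast
  next
    fix a x assume "x \<in> Cg"
    then obtain P where "x = \<Phi> (g * P)" unfolding Cg_eq by blast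
    then have "vsc a x = \<Phi> (g * smult a P)" by (simp add: \<Phi>_smult)
    then show "vsc a x \<in> Cg" unfolding Cg_eq by blast
  qed

  \<comment> \<open>Reduction modulo the factors of \<open>f\<close>\<close>
  have B_into: "mat_act n (em (Bmat (F i))) ` Cg \<subseteq> C i" if i: "i < s" for i
  proof -
    obtain q where "g = gs i * q" using gsg[OF i] by (auto elim: dvdE)
    then show ?thesis
      unfolding Cg_eq C_eq[OF i] using Bmat_\<Phi>[OF Fdvd F0] i by (auto simp: mult.assoc)
  qed
  have B_inj: "c = 0" if c: "c \<in> Cg" "\<And>i. i \<in> \<Lambda> \<Longrightarrow> mat_act n (em (Bmat (F i))) c = 0" for c
  proof -
    obtain P where P: "c = \<Phi> (g * P)" using c(1) unfolding Cg_eq by blast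
    \<comment> \<open>For \<open>i\<close> in \<Lambda> this is the vanishing of the reduction; for
      the others \<open>gs i\<close> is the whole factor and already divides \<open>g\<close>.
      Comaximality then collects the factors into \<open>mp f\<close>.\<close>
    have "mp (F i) dvd g * P" if i: "i < s" for i
    proof (cases "i \<in> \<Lambda>")
      case True
      have "coeff (g * P mod mp (F i)) = 0"
        using c(2)[OF True] unfolding P Bmat_\<Phi>[OF Fdvd[OF i] F0[OF i]] .
      then show ?thesis by (auto simp: coeff_eq_0_fun_iff)
    next
      case False
      then have "gs i = mp (F i)" using i by (simp add: \<Lambda>_def F_def)
      then show ?thesis using gsg[OF i] by simp
    qed
    then have "(\<Prod>i<s. mp (F i)) dvd g * P"
      using comaxF comax_mp by (intro comax_prod_dvd) auto
    then show ?thesis unfolding P \<Phi>_eq_0_iff f_prod mp_prod .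
  qed

  \<comment> \<open>Multiplication by the cofactors\<close>
  have A_act: "\<exists>Q. c = coeff Q \<and> coeff Q \<in> vecs (d i) \<and> gs i dvd Q \<and>
      mat_act (d i) (em (Amat (h i))) c = \<Phi> (mp (h i) * Q)" if ic: "i < s" "c \<in> C i" for i c
  proof -
    obtain P where P: "c = coeff (gs i * P mod mp (F i))" using ic C_eq by blast
    let ?Q = "gs i * P mod mp (F i)"
    have "coeff ?Q \<in> vecs (d i)"
      using coeff_mod_in_vecs[of "mp (F i)" "gs i * P"] F0[OF ic(1)] Fdeg[OF ic(1)] by simp
    moreover have "gs i dvd ?Q" using gdvd[OF ic(1)] by (simp add: dvd_mod)
    ultimately show ?thesis using P Amat_coeff by blast
  qed
  have A_into: "mat_act (d i) (em (Amat (h i))) c \<in> Cg" if ic: "i < s" "c \<in> C i" for i c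
  proof -
    obtain Q where Q: "gs i dvd Q" "mat_act (d i) (em (Amat (h i))) c = \<Phi> (mp (h i) * Q)"
      using A_act[OF ic] by blast
    \<comment> \<open>The other generators \<open>gs j\<close> divide \<open>h i\<close> factor by
      factor, and \<open>gs i\<close> divides \<open>Q\<close>; together they form
      \<open>g\<close>.\<close>
    have "(\<Prod>j\<in>{..<s} - {i}. gs j) dvd mp (h i)"
      unfolding h_def mp_prod using gdvd by (intro prod_dvd_prod) auto
    then have "(\<Prod>j\<in>{..<s} - {i}. gs j) * gs i dvd mp (h i) * Q"
      using Q(1) by (rule mult_dvd_mono)
    moreover have "g = (\<Prod>j\<in>{..<s} - {i}. gs j) * gs i"
      unfolding g_prod using ic(1) by (simp add: prod.remove mult.commute)
    ultimately obtain R where "mp (h i) * Q = g * R" by (auto elim: dvdE)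
    then show ?thesis unfolding Cg_eq Q(2) by simp
  qed
  have BA_eq_0: "mat_act n (em (Bmat (F i))) (mat_act (d j) (em (Amat (h j))) c) = 0"
    if ic: "i < s" "j < s" "i \<noteq> j" "c \<in> C j" for i j c
  proof -
    obtain Q where Q: "mat_act (d j) (em (Amat (h j))) c = \<Phi> (mp (h j) * Q)"
      using A_act[OF ic(2,4)] by blast
    \<comment> \<open>For \<open>i\<close> different from \<open>j\<close>, \<open>F i\<close> is
      one of the factors of \<open>h j\<close>, so the product vanishes modulo
      \<open>F i\<close>.\<close>
    have "mp (F i) dvd mp (h j)"
      unfolding h_def mp_prod using ic by (intro dvd_prodI) auto
    then show ?thesis
      unfolding Q Bmat_\<Phi>[OF Fdvd[OF ic(1)] F0[OF ic(1)]] by (simp add: coeff_eq_0_fun_iff mod_eq_0_iff_dvd)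
  qed
  have BA_inj: "c = 0"
    if ic: "i < s" "c \<in> C i" "mat_act n (em (Bmat (F i))) (mat_act (d i) (em (Amat (h i))) c) = 0" for i c
  proof -
    obtain Q where Q: "c = coeff Q" "coeff Q \<in> vecs (d i)"
        "mat_act (d i) (em (Amat (h i))) c = \<Phi> (mp (h i) * Q)"
      using A_act[OF ic(1,2)] by blast
    have "mp (F i) dvd mp (h i) * Q"
      using ic(3) unfolding Q(3) Bmat_\<Phi>[OF Fdvd[OF ic(1)] F0[OF ic(1)]] coeff_eq_0_fun_iff by auto
    \<comment> \<open>\<open>h i\<close> is invertible modulo \<open>F i\<close>, so it can be
      cancelled.\<close>
    moreover have "comax (mp (F i)) (mp (h i))"
      unfolding h_def using comaxF ic(1) by (intro comax_mp comax_prod) auto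
    ultimately have "mp (F i) dvd Q" using comax_dvd_mult by blast
    moreover have "Q mod mp (F i) = Q"
      using Q(2) Fdeg[OF ic(1)] by (intro poly_mod_unique) auto
    ultimately have "Q = 0" by (metis mod_eq_0_iff_dvd)
    then show ?thesis using Q(1) by simp
  qed

  \<comment> \<open>Dimensions of the component codes\<close>
  have gs_deg: "degree (gs i) \<le> d i" if "i < s" for i
    using dvd_imp_degree_le[OF gdvd[OF that]] F0[OF that] Fdeg[OF that] by simp
  \<comment> \<open>A monic divisor of \<open>mp (F i)\<close> of full degree equals it, which
    membership in \<Lambda> excludes.\<close>
  have kk_pos: "1 \<le> kk i" if "i \<in> \<Lambda>" for i
  proof (rule ccontr)
    assume "\<not> 1 \<le> kk i"
    have i: "i < s" and ne: "gs i \<noteq> mp (F i)" using that by (auto simp: \<Lambda>_def F_def)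
    have eq: "degree (gs i) = degree (mp (F i))"
      using \<open>\<not> 1 \<le> kk i\<close> gs_deg[OF i] Fdeg[OF i] by (simp add: kk_def d_def)
    obtain q where q: "mp (F i) = gs i * q" using gdvd[OF i] by (auto elim: dvdE)
    then have "gs i \<noteq> 0" "q \<noteq> 0" using F0[OF i] by (auto simp flip: mp_eq_0_iff)
    then have "degree q = 0" using eq q by (simp add: degree_mult_eq)
    then obtain a where a: "q = [:a:]" by (auto elim: degree_eq_zeroE)
    have "lead_coeff (mp (F i)) = lead_coeff (gs i) * lead_coeff q" by (simp only: q lead_coeff_mult)
    then have "a = 1" using Fmon[OF i] gmon[OF i] a by simp
    then show False using q a ne by simp
  qed
  have sum_kk: "k = (\<Sum>i\<in>\<Lambda>. kk i)"
  proof -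
    \<comment> \<open>Indices outside \<Lambda> have capacity 0, and the total over all indices is
      \<open>n\<close> minus the degree of \<open>g\<close>. \<open>gs_deg\<close> and
      \<open>kn\<close> keep the subtractions on naturals exact.\<close>
    have "(\<Sum>i\<in>\<Lambda>. kk i) = (\<Sum>i<s. kk i)"
    proof (rule sum.mono_neutral_left)
      show "\<forall>i\<in>{..<s} - \<Lambda>. kk i = 0"
      proof
        fix i assume "i \<in> {..<s} - \<Lambda>"
        then have "i < s" "gs i = mp (F i)" by (auto simp: \<Lambda>_def F_def)
        then show "kk i = 0" using Fdeg by (simp add: kk_eq)
      qed
    qed (auto simp: \<Lambda>_def)
    also have "(\<Sum>i<s. kk i) = (\<Sum>i<s. d i) - (\<Sum>i<s. degree (gs i))"
      unfolding kk_def d_def using gs_deg by (intro sum_subtractf_nat) (simp add: d_def)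
    also have "(\<Sum>i<s. d i) = n"
    proof -
      have "n = (\<Sum>i<s. degree (F i))"
        unfolding f_deg[symmetric] f_prod using F0 by (intro degree_prod_sum_eq) auto
      then show ?thesis using Fdeg by simp
    qed
    also have "(\<Sum>i<s. degree (gs i)) = n - k"
    proof -
      have "gs i \<noteq> 0" if "i < s" for i using gmon[OF that] by auto
      then have "degree g = (\<Sum>i<s. degree (gs i))"
        unfolding g_prod by (intro degree_prod_sum_eq) auto
      then show ?thesis using g_deg by simp
    qed
    finally show ?thesis using kn by simp
  qed

  \<comment> \<open>Comparison of the weights\<close>
  let ?W = "\<lambda>i. gen_rank_weight emb (C i)" and ?G = "gen_rank_weight emb Cg"
  have W_le: "?W i r \<le> degree (gs i) + r" if i: "i \<in> \<Lambda>" "r \<le> kk i" for i r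
  proof -
    obtain D where "vsc.subspace D" "D \<subseteq> C i" "vsc.dim D = r" "wtR emb D \<le> degree (gs i) + r"
      using C_subcode \<Lambda>(2) i by blast
    then show ?thesis using gen_rank_weight_le[of D "C i" r emb] by simp
  qed
  have subcode: "\<exists>D. vsc.subspace D \<and> D \<subseteq> Cg \<and> vsc.dim D = (\<Sum>i\<in>\<Lambda>. rr i)
      \<and> wtR emb D \<le> (\<Sum>i\<in>\<Lambda>. ?W i (rr i))" if rr: "\<forall>i\<in>\<Lambda>. rr i \<le> kk i" for rr
  proof -
    \<comment> \<open>In each component an optimal subcode is taken, which requires that some
      subcode of this dimension exists.\<close>
    have "\<exists>D. vsc.subspace D \<and> D \<subseteq> C i \<and> vsc.dim D = rr i \<and> wtR emb D = ?W i (rr i)" if i: "i \<in> \<Lambda>" for i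
    proof -
      obtain D where "vsc.subspace D" "D \<subseteq> C i" "vsc.dim D = rr i"
        using C_subcode \<Lambda>(2) rr i by blast
      then show ?thesis using gen_rank_weight_attained by metis
    qed
    then obtain D where D: "\<And>i. i \<in> \<Lambda> \<Longrightarrow> vsc.subspace (D i)" "\<And>i. i \<in> \<Lambda> \<Longrightarrow> D i \<subseteq> C i"
        "\<And>i. i \<in> \<Lambda> \<Longrightarrow> vsc.dim (D i) = rr i" "\<And>i. i \<in> \<Lambda> \<Longrightarrow> wtR emb (D i) = ?W i (rr i)"
      by metis
    have "\<exists>D'. vsc.subspace D' \<and> D' \<subseteq> Cg \<and> vsc.dim D' = (\<Sum>i\<in>\<Lambda>. vsc.dim (D i))
        \<and> wtR emb D' \<le> (\<Sum>i\<in>\<Lambda>. wtR emb (D i))"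
    proof (rule exists_sum_subcode[OF \<Lambda>(1) Cg_sub Cg_vecs])
      show "vsc.subspace (D i)" if "i \<in> \<Lambda>" for i using D(1) that .
      show "D i \<subseteq> vecs (d i)" if "i \<in> \<Lambda>" for i
        using D(2)[OF that] C_vecs[OF \<Lambda>(2)[OF that]] by blast
      show "mat_act (d i) (em (Amat (h i))) ` D i \<subseteq> Cg" if "i \<in> \<Lambda>" for i
        using D(2)[OF that] A_into[OF \<Lambda>(2)[OF that]] by blast
      show "mat_act n (em (Bmat (F i))) (mat_act (d j) (em (Amat (h j))) c) = 0"
        if "i \<in> \<Lambda>" "j \<in> \<Lambda>" "i \<noteq> j" "c \<in> D j" for i j c
        using BA_eq_0[OF \<Lambda>(2)[OF that(1)] \<Lambda>(2)[OF that(2)] that(3)] D(2)[OF that(2)] that(4) by blast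
      show "c = 0" if "i \<in> \<Lambda>" "c \<in> D i"
          "mat_act n (em (Bmat (F i))) (mat_act (d i) (em (Amat (h i))) c) = 0" for i c
        using BA_inj[OF \<Lambda>(2)[OF that(1)] _ that(3)] D(2)[OF that(1)] that(2) by blast
    qed
    then show ?thesis using D(3,4) by simp
  qed
  have lower: "\<exists>rr\<in>{rr. (\<forall>i\<in>\<Lambda>. rr i \<le> kk i) \<and> (\<Sum>i\<in>\<Lambda>. rr i) = r}. (\<Sum>i\<in>\<Lambda>. ?W i (rr i)) \<le> ?G r"
    if "r \<le> k" for r
  proof -
    \<comment> \<open>As \<open>k\<close> is the sum of the capacities, \<open>r\<close> can be
      distributed; the resulting subcode of dimension \<open>r\<close> ensures that the weight of
      \<open>Cg\<close> is attained.\<close>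
    obtain rr0 where "\<forall>i\<in>\<Lambda>. rr0 i \<le> kk i" "(\<Sum>i\<in>\<Lambda>. rr0 i) = r"
      using exists_distribution[OF \<Lambda>(1)] \<open>r \<le> k\<close> sum_kk by metis
    then obtain D0 where "vsc.subspace D0" "D0 \<subseteq> Cg" "vsc.dim D0 = r"
      using subcode by metis
    then obtain D where D: "vsc.subspace D" "D \<subseteq> Cg" "vsc.dim D = r" "wtR emb D = ?G r"
      by (rule gen_rank_weight_attained)
    have "\<exists>rr. (\<forall>i\<in>\<Lambda>. \<exists>D'. vsc.subspace D' \<and> D' \<subseteq> C i \<and> vsc.dim D' = rr i)
        \<and> (\<Sum>i\<in>\<Lambda>. rr i) = vsc.dim D \<and> (\<Sum>i\<in>\<Lambda>. ?W i (rr i)) \<le> wtR emb D"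
    proof (rule exists_rank_distribution[OF \<Lambda>(1) D(1)])
      show "D \<subseteq> vecs n" using D(2) Cg_vecs by blast
      show "mat_act n (em (Bmat (F i))) ` D \<subseteq> C i" if "i \<in> \<Lambda>" for i
        using B_into[OF \<Lambda>(2)[OF that]] D(2) by blast
      show "c = 0" if "c \<in> D" "\<And>i. i \<in> \<Lambda> \<Longrightarrow> mat_act n (em (Bmat (F i))) c = 0" for c
        using B_inj that D(2) by blast
    qed
    then obtain rr where rr: "\<forall>i\<in>\<Lambda>. \<exists>D'. vsc.subspace D' \<and> D' \<subseteq> C i \<and> vsc.dim D' = rr i"
        "(\<Sum>i\<in>\<Lambda>. rr i) = r" "(\<Sum>i\<in>\<Lambda>. ?W i (rr i)) \<le> ?G r"
      using D(3,4) by metis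
    \<comment> \<open>Each \<open>rr i\<close> is the dimension of an actual subcode of
      \<open>C i\<close>, so it respects the capacity.\<close>
    have "\<forall>i\<in>\<Lambda>. rr i \<le> kk i" using rr(1) C_dim \<Lambda>(2) by metis
    then show ?thesis using rr(2,3) by blast
  qed
  have upper: "?G r \<le> (\<Sum>i\<in>\<Lambda>. ?W i (rr i))"
    if rr: "rr \<in> {rr. (\<forall>i\<in>\<Lambda>. rr i \<le> kk i) \<and> (\<Sum>i\<in>\<Lambda>. rr i) = r}" for r rr
  proof -
    obtain D where "vsc.subspace D" "D \<subseteq> Cg" "vsc.dim D = r" "wtR emb D \<le> (\<Sum>i\<in>\<Lambda>. ?W i (rr i))"
      using subcode[of rr] rr by auto
    then show ?thesis using gen_rank_weight_le[of D Cg r emb] by simp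
  qed
  have W0: "?W i 0 = 0" for i by (simp add: gen_rank_weight_def)
  have d_eq: "d i = degree (gs i) + kk i" if "i \<in> \<Lambda>" for i
    using gs_deg[OF \<Lambda>(2)[OF that]] by (simp add: kk_def d_def)
  note bounds = distribution_bounds[of \<Lambda> k kk ?W "\<lambda>i. degree (gs i)" d ?G,
      OF \<Lambda>(1) sum_kk k1 kk_pos W0 W_le d_eq upper lower]
  show ?thesis
    using bounds W_le by auto
qed

end
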